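(* Let $\alpha\in(0,1)$ and suppose $n-|\tau_0|>4$. For any finite $n$ and $p$ and any (arbitrarily small) $\delta>0$, there exists a constant $\gamma_\delta\in(0,1)$ such that, when $$\lambda\in\Big[4n\gamma_\delta^{1/2}\Big\{2+2(|\tau_0|+1)\frac{\log(p/2)}{n}\Big\}\sigma_0^2,\ \frac{n\gamma_\delta^{1/4}}{6}C_{\min}\Big],$$ the model confidence set $\bar\Gamma_\alpha^\tau$ satisfies $$\mathbb P_{(\mathcal U^d,Y)}\{\tau_0\in\bar\Gamma_\alpha^\tau(Y)\}\ge\alpha-\delta-o(e^{-c_1d})\quad\text{as }d\to\infty$$ for some $c_1>0$. Further, $\mathbb P_{Y|\mathcal U^d}\{\tau_0\in\bar\Gamma_\alpha^\tau(Y)\}\ge\alpha-\delta-o_p(e^{-c_1d})$.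
   Context: Setting. $n,p$ are positive integers and $X\in\mathbb R^{n\times p}$ is a fixed matrix. For $\tau\subset[p]=\{1,\dots,p\}$ (a "model"), $X_\tau$ is the submatrix of the columns of $X$ indexed by $\tau$, $|\tau|$ is the cardinality, and $H_\tau$ is the orthogonal projection matrix onto the column span of $X_\tau$. The data are $Y=X_{\tau_0}\beta_0+\sigma_0U$, where $\tau_0\subset[p]$ (nonempty), $\beta_0\in\mathbb R^{|\tau_0|}$, $\sigma_0>0$ are fixed and $U\sim N(0,I_n)$. Identifiability: $\tau_0$ is the unique model of smallest cardinality in $\{\tau\subset[p]: X_\tau\beta_\tau=X_{\tau_0}\beta_0\text{ for some }\beta_\tau\}$. Define $$C_{\min}=\min_{\tau\ne\tau_0,\ |\tau|\le|\tau_0|}\ \min_{\beta_\tau\in\mathbb R^{|\tau|}}\ \frac{\|X_{\tau_0}\beta_0-X_\tau\beta_\tau\|_2^2}{n\max(|\tau_0\setminus\tau|,1)}>0.$$ Candidate set. $\mathcal U^d=(U_1^*,\dots,U_d^* )$ are i.i.d. $N(0,I_n)$, independent of $U$. For $\lambda>0$, $\hat\tau_b=\arg\min_{\tau}\min_{\beta_\tau\in\mathbb R^{|\tau|},\sigma\in\mathbb R}\{\|Y-X_\tau\beta_\tau-\sigma U_b^*\|_2^2+\lambda|\tau|\}$ (fixed tie-breaking rule) and $S^{(d)}=\{\hat\tau_b:b=1,\dots,d\}$. Confidence set. For $y\in\mathbb R^n$ and a model $\tau$ let $\tilde T(y,\tau)=\arg\min_{\tilde\tau\subset[p],|\tilde\tau|\le|\tau|}\min_{\beta_{\tilde\tau}}\|y-X_{\tilde\tau}\beta_{\tilde\tau}\|^2$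 (fixed tie-breaking rule) and $\widetilde W(y,\tau)=(H_\tau y,\ \|(I-H_\tau)y\|)$. For $w=(a,b)$ and a model $\tau'$ let $$p_{(w,\tau)}(\tau')=\mathbb P_{V}\Big\{\tilde T\Big(a+b\tfrac{(I-H_\tau)V}{\|(I-H_\tau)V\|},\tau\Big)=\tau'\Big\},\quad V\sim N(0,I_n),$$ which is the conditional probability mass function of $\tilde T(Y_\theta,\tau)$ given $\widetilde W(Y_\theta,\tau)=w$ when $Y_\theta=X_\tau\beta_\tau+\sigma V$. Let $$B_\alpha(\tau,w)=\Big\{\tau^*\subset[p]:\sum_{\tau':\,p_{(w,\tau)}(\tau')\le p_{(w,\tau)}(\tau^* )}p_{(w,\tau)}(\tau')\ge1-\alpha\Big\},$$ $$\bar\Gamma_\alpha^\tau(Y)=\{\tau\in S^{(d)}:\tilde T(Y,\tau)\in B_\alpha(\tau,\widetilde W(Y,\tau))\}.$$ $\mathbb P_{(\mathcal U^d,Y)}$ is the joint probability over $U$ and $\mathcal U^d$; $\mathbb P_{Y|\mathcal U^d}$ is the conditional probability given $\mathcal U^d$, and $o_p$ is with respect to $\mathcal U^d$ as $d\to\infty$. *)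

theory Defs
  imports "HOL-Probability.Probability"
begin

section \<open>Linear submodels\<close>

text \<open>
  The design matrix is \<open>X :: real^'p^'n\<close>, so that \<open>n = CARD('n)\<close> and \<open>p = CARD('p)\<close>; a model is a
  set \<open>\<tau> :: 'p set\<close> of column indices, the empty model included.  A coefficient vector in
  \<open>\<real>\<close> to the power \<open>|\<tau>|\<close> is represented by a vector \<open>\<beta> :: real^'p\<close> of which only the entries with
  index in \<open>\<tau>\<close> are ever used; quantifying or minimising over all \<open>\<beta> :: real^'p\<close> is therefore the
  same as doing so over the coefficient vectors of the submodel.
\<close>

definition submodel :: "real^'p^'n \<Rightarrow> 'p set \<Rightarrow> real^'p \<Rightarrow> real^'n" where
  "submodel X \<tau> \<beta> = (\<Sum>j\<in>\<tau>. \<beta> $ j *\<^sub>R column j X)"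

definition column_span :: "real^'p^'n \<Rightarrow> 'p set \<Rightarrow> (real^'n) set" where
  "column_span X \<tau> = span ((\<lambda>j. column j X) ` \<tau>)"

definition hat_matrix :: "real^'p^'n \<Rightarrow> 'p set \<Rightarrow> real^'n^'n" where
  "hat_matrix X \<tau> = (THE H. \<forall>y. H *v y \<in> column_span X \<tau> \<and>
     (\<forall>z\<in>column_span X \<tau>. orthogonal (y - H *v y) z))"

definition residual :: "real^'p^'n \<Rightarrow> 'p set \<Rightarrow> real^'n \<Rightarrow> real^'n" where
  "residual X \<tau> y = (mat 1 - hat_matrix X \<tau>) *v y"

text \<open>The infima below are minima of least squares problems; they are attained.\<close>

definition rss :: "real^'p^'n \<Rightarrow> 'p set \<Rightarrow> real^'n \<Rightarrow> real" where
  "rss X \<tau> y = (INF \<beta>. (norm (y - submodel X \<tau> \<beta>))\<^sup>2)"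

definition identifiable :: "real^'p^'n \<Rightarrow> 'p set \<Rightarrow> real^'p \<Rightarrow> bool" where
  "identifiable X \<tau>\<^sub>0 \<beta>\<^sub>0 \<longleftrightarrow>
     {\<tau>. is_arg_min card (\<lambda>\<tau>. \<exists>\<beta>. submodel X \<tau> \<beta> = submodel X \<tau>\<^sub>0 \<beta>\<^sub>0) \<tau>} = {\<tau>\<^sub>0}"

definition C_min :: "real^'p^'n \<Rightarrow> 'p set \<Rightarrow> real^'p \<Rightarrow> real" where
  "C_min X \<tau>\<^sub>0 \<beta>\<^sub>0 = (MIN \<tau>\<in>{\<tau>. \<tau> \<noteq> \<tau>\<^sub>0 \<and> card \<tau> \<le> card \<tau>\<^sub>0}.
     INF \<beta>. (norm (submodel X \<tau>\<^sub>0 \<beta>\<^sub>0 - submodel X \<tau> \<beta>))\<^sup>2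
              / (real CARD('n) * real (max (card (\<tau>\<^sub>0 - \<tau>)) 1)))"

section \<open>Candidate set and confidence set\<close>

text \<open>A fixed tie-breaking rule picks one element from every nonempty set of minimisers.\<close>

definition tie_breaking :: "('a set \<Rightarrow> 'a) \<Rightarrow> bool" where
  "tie_breaking tb \<longleftrightarrow> (\<forall>A. A \<noteq> {} \<longrightarrow> tb A \<in> A)"

definition tau_hat ::
  "('p set set \<Rightarrow> 'p set) \<Rightarrow> real^'p^'n \<Rightarrow> real \<Rightarrow> real^'n \<Rightarrow> real^'n \<Rightarrow> 'p set" where
  "tau_hat tb X lam y u = tb {\<tau>. is_arg_min
     (\<lambda>\<tau>. INF (\<beta>, \<sigma>). (norm (y - submodel X \<tau> \<beta> - \<sigma> *\<^sub>R u))\<^sup>2 + lam * real (card \<tau>))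
     (\<lambda>_. True) \<tau>}"

definition candidate_set ::
  "('p set set \<Rightarrow> 'p set) \<Rightarrow> real^'p^'n \<Rightarrow> real \<Rightarrow> real^'n \<Rightarrow> (nat \<Rightarrow> real^'n) \<Rightarrow> nat \<Rightarrow> 'p set set"
where
  "candidate_set tb X lam y u d = (\<lambda>b. tau_hat tb X lam y (u b)) ` {..<d}"

definition T_tilde ::
  "('p set set \<Rightarrow> 'p set) \<Rightarrow> real^'p^'n \<Rightarrow> real^'n \<Rightarrow> 'p set \<Rightarrow> 'p set" where
  "T_tilde tb X y \<tau> = tb {\<tau>'. is_arg_min (\<lambda>\<tau>'. rss X \<tau>' y) (\<lambda>\<tau>'. card \<tau>' \<le> card \<tau>) \<tau>'}"

definition W_tilde :: "real^'p^'n \<Rightarrow> real^'n \<Rightarrow> 'p set \<Rightarrow> (real^'n) \<times> real" where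
  "W_tilde X y \<tau> = (hat_matrix X \<tau> *v y, norm (residual X \<tau> y))"

definition std_normal_vec :: "(real^'n) measure" where
  "std_normal_vec = density lborel (\<lambda>x. ennreal (\<Prod>i\<in>UNIV. std_normal_density (x $ i)))"

text \<open>If \<open>residual X \<tau> v = 0\<close>, the normalised residual below is \<open>0\<close>.  This happens on a null set of
  \<open>v\<close>, unless the columns in \<open>\<tau>\<close> span the whole space, in which case \<open>snd (W_tilde X y \<tau>) = 0\<close>.\<close>

definition cond_pmf ::
  "('p set set \<Rightarrow> 'p set) \<Rightarrow> real^'p^'n \<Rightarrow> (real^'n) \<times> real \<Rightarrow> 'p set \<Rightarrow> 'p set \<Rightarrow> real" where
  "cond_pmf tb X w \<tau> \<tau>' = measure std_normal_vec
     {v. T_tilde tb X (fst w + snd w *\<^sub>R (residual X \<tau> v /\<^sub>R norm (residual X \<tau> v))) \<tau> = \<tau>'}"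

definition B_set ::
  "('p set set \<Rightarrow> 'p set) \<Rightarrow> real^'p^'n \<Rightarrow> real \<Rightarrow> 'p set \<Rightarrow> (real^'n) \<times> real \<Rightarrow> 'p set set" where
  "B_set tb X \<alpha> \<tau> w = {\<tau>s.
     (\<Sum>\<tau>' | cond_pmf tb X w \<tau> \<tau>' \<le> cond_pmf tb X w \<tau> \<tau>s. cond_pmf tb X w \<tau> \<tau>') \<ge> 1 - \<alpha>}"

text \<open>\<open>tbS\<close> breaks the ties in the construction of the candidate set, \<open>tbT\<close> those in the nuclear
  statistic \<open>T_tilde\<close>.\<close>

definition confidence_set ::
  "('p set set \<Rightarrow> 'p set) \<Rightarrow> ('p set set \<Rightarrow> 'p set) \<Rightarrow> real^'p^'n \<Rightarrow> real \<Rightarrow> real \<Rightarrow>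
     real^'n \<Rightarrow> (nat \<Rightarrow> real^'n) \<Rightarrow> nat \<Rightarrow> 'p set set" where
  "confidence_set tbS tbT X \<alpha> lam y u d =
     {\<tau> \<in> candidate_set tbS X lam y u d. T_tilde tbT X y \<tau> \<in> B_set tbT X \<alpha> \<tau> (W_tilde X y \<tau>)}"

section \<open>Probabilistic notions\<close>

text \<open>\<open>sigma_Ud M Us d\<close> is the sub-sigma-algebra of \<open>M\<close> generated by \<open>Us 0, \<dots>, Us (d - 1)\<close>.\<close>

definition sigma_Ud :: "'w measure \<Rightarrow> (nat \<Rightarrow> 'w \<Rightarrow> real^'n) \<Rightarrow> nat \<Rightarrow> 'w measure" where
  "sigma_Ud M Us d =
     vimage_algebra (space M) (\<lambda>\<omega>. \<lambda>b\<in>{..<d}. Us b \<omega>) (\<Pi>\<^sub>M b\<in>{..<d}. borel)"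

text \<open>\<open>R d = o\<^sub>p(a d)\<close>, i.e. \<open>R d / a d\<close> tends to \<open>0\<close> in probability as \<open>d\<close> tends to infinity.\<close>

definition little_o_p :: "'w measure \<Rightarrow> (nat \<Rightarrow> 'w \<Rightarrow> real) \<Rightarrow> (nat \<Rightarrow> real) \<Rightarrow> bool" where
  "little_o_p M R a \<longleftrightarrow>
     (\<forall>\<epsilon>>0. (\<lambda>d. measure M {\<omega> \<in> space M. \<bar>R d \<omega> / a d\<bar> > \<epsilon>}) \<longlonglongrightarrow> 0)"

section \<open>Well-definedness\<close>

lemma range_submodel:
  fixes X :: "real^'p^'n"
  shows "range (submodel X \<tau>) = column_span X \<tau>"
proof -
  have "\<exists>\<beta>. y = submodel X \<tau> \<beta>" if "y \<in> column_span X \<tau>" for y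
  proof -
    have "y \<in> span ((\<lambda>j. column j X) ` \<tau>)" using that by (simp add: column_span_def)
    then show ?thesis
    proof (induction rule: span_induct_alt)
      case base
      show ?case by (intro exI[of _ 0]) (simp add: submodel_def)
    next
      case (step c x y)
      then obtain j \<beta> where j: "j \<in> \<tau>" "x = column j X" and y: "y = submodel X \<tau> \<beta>" by auto
      have "submodel X \<tau> (c *\<^sub>R axis j 1 + \<beta>) = (\<Sum>i\<in>\<tau>. (c *\<^sub>R axis j 1 :: real^'p) $ i *\<^sub>R column i X) + y"
        by (simp add: submodel_def y scaleR_left_distrib sum.distrib)
      also have "(\<Sum>i\<in>\<tau>. (c *\<^sub>R axis j 1 :: real^'p) $ i *\<^sub>R column i X) =
                 (\<Sum>i\<in>\<tau>. if i = j then c *\<^sub>R x else 0)"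
        by (intro sum.cong) (auto simp: axis_def j)
      also have "\<dots> = c *\<^sub>R x" using j by simp
      finally show ?case by metis
    qed
  qed
  moreover have "submodel X \<tau> \<beta> \<in> column_span X \<tau>" for \<beta>
    unfolding submodel_def column_span_def by (intro span_sum span_mul span_base) auto
  ultimately show ?thesis by blast
qed

lemma hat_matrix_ex1:
  "\<exists>!H::real^'n^'n. \<forall>y. H *v y \<in> column_span X \<tau> \<and>
     (\<forall>z\<in>column_span X \<tau>. orthogonal (y - H *v y) z)"
proof -
  let ?S = "column_span X \<tau>"
  have S: "subspace ?S" by (simp add: column_span_def)
  have uniq: "a = b" if "a \<in> ?S" "b \<in> ?S" "\<forall>z\<in>?S. orthogonal (y - a) z" "\<forall>z\<in>?S. orthogonal (y - b) z"
    for a b y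
  proof -
    have "a - b \<in> ?S" using S that by (simp add: subspace_diff)
    then have "orthogonal (y - a) (a - b)" "orthogonal (y - b) (a - b)" using that by auto
    then have "(a - b) \<bullet> (a - b) = 0"
      by (simp add: orthogonal_def inner_diff_left inner_diff_right inner_commute)
    then show ?thesis by simp
  qed
  have "\<exists>a. a \<in> ?S \<and> (\<forall>z\<in>?S. orthogonal (y - a) z)" for y
  proof -
    obtain a b where "a \<in> span ?S" "\<And>w. w \<in> span ?S \<Longrightarrow> orthogonal b w" "y = a + b"
      using orthogonal_subspace_decomp_exists[of ?S y] by metis
    moreover have "span ?S = ?S" by (simp add: column_span_def span_span)
    ultimately show ?thesis by (intro exI[of _ a]) simp
  qed
  then obtain f where f: "\<And>y. f y \<in> ?S" "\<And>y z. z \<in> ?S \<Longrightarrow> orthogonal (y - f y) z" by metis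
  have "linear f"
  proof (rule linearI)
    fix x y
    have "\<forall>z\<in>?S. orthogonal (x + y - (f x + f y)) z"
      using f(2)[of _ x] f(2)[of _ y]
      by (auto simp: orthogonal_def inner_diff_left inner_add_left)
    then show "f (x + y) = f x + f y"
      using uniq[of "f (x + y)" "f x + f y" "x + y"] f S by (auto simp: subspace_add)
  next
    fix c x
    have "\<forall>z\<in>?S. orthogonal (c *\<^sub>R x - c *\<^sub>R f x) z"
      using f(2)[of _ x] by (auto simp: orthogonal_def inner_diff_left)
    then show "f (c *\<^sub>R x) = c *\<^sub>R f x"
      using uniq[of "f (c *\<^sub>R x)" "c *\<^sub>R f x" "c *\<^sub>R x"] f S by (auto simp: subspace_scale)
  qed
  then have m: "matrix f *v y = f y" for y by (simp add: matrix_works)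
  show ?thesis
  proof (intro ex1I[of _ "matrix f"])
    show "\<forall>y. matrix f *v y \<in> ?S \<and> (\<forall>z\<in>?S. orthogonal (y - matrix f *v y) z)"
      using f m by auto
  next
    fix H :: "real^'n^'n"
    assume H: "\<forall>y. H *v y \<in> ?S \<and> (\<forall>z\<in>?S. orthogonal (y - H *v y) z)"
    have "H *v y = matrix f *v y" for y
      unfolding m using H f by (intro uniq[of _ _ y]) auto
    then show "H = matrix f" by (simp add: matrix_eq)
  qed
qed

lemma hat_matrix:
  "hat_matrix X \<tau> *v y \<in> column_span X \<tau>"
  "z \<in> column_span X \<tau> \<Longrightarrow> orthogonal (y - hat_matrix X \<tau> *v y) z"
  using theI'[OF hat_matrix_ex1[of X \<tau>]] unfolding hat_matrix_def by auto

lemma rss_eq: "rss X \<tau> y = (norm (residual X \<tau> y))\<^sup>2"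
proof -
  let ?h = "hat_matrix X \<tau> *v y"
  have r: "residual X \<tau> y = y - ?h"
    by (simp add: residual_def matrix_vector_mult_diff_rdistrib)
  obtain \<beta>' where \<beta>': "?h = submodel X \<tau> \<beta>'"
    using hat_matrix(1)[of X \<tau> y] range_submodel[of X \<tau>] by blast
  have le: "(norm (y - ?h))\<^sup>2 \<le> (norm (y - submodel X \<tau> \<beta>))\<^sup>2" for \<beta>
  proof -
    have "?h - submodel X \<tau> \<beta> \<in> column_span X \<tau>"
      using hat_matrix(1)[of X \<tau> y] range_submodel[of X \<tau>]
      by (metis column_span_def rangeI span_diff)
    then have "orthogonal (y - ?h) (?h - submodel X \<tau> \<beta>)" by (rule hat_matrix(2))
    then have "(norm ((y - ?h) + (?h - submodel X \<tau> \<beta>)))\<^sup>2 =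
        (norm (y - ?h))\<^sup>2 + (norm (?h - submodel X \<tau> \<beta>))\<^sup>2"
      by (rule norm_add_Pythagorean)
    then show ?thesis by simp
  qed
  show ?thesis unfolding rss_def r
  proof (rule cInf_eq_minimum)
    show "(norm (y - ?h))\<^sup>2 \<in> range (\<lambda>\<beta>. (norm (y - submodel X \<tau> \<beta>))\<^sup>2)" using \<beta>' by auto
  qed (use le in auto)
qed

end

theory Submission
  imports Defs
begin

text \<open>
  Let \<open>y = X\<^sub>\<tau>\<^sub>0 \<beta>\<^sub>0 + \<sigma>\<^sub>0 u\<close>.  Given \<open>W_tilde\<close>, the direction of the residual at the true model is
  distributed as the direction of an independent copy, so \<open>cond_pmf\<close> is the conditional law of
  \<open>T_tilde\<close> and the highest density set \<open>B_set\<close> has coverage at least \<open>\<alpha>\<close>.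

  For the candidate set, no explicit rate is needed because \<open>\<gamma>\<close> may depend on everything.  The
  squared distance of \<open>y\<close> to the span of \<open>u\<close> and the columns of a wrong model of size at most
  \<open>|\<tau>\<^sub>0|\<close> is almost surely positive, hence exceeds some \<open>\<kappa> > 0\<close> with probability greater than
  \<open>1 - \<delta>\<close>; choose \<open>\<gamma>\<close> such that every admissible penalty satisfies \<open>\<lambda> |\<tau>\<^sub>0| \<le> \<kappa>\<close>.  Then \<open>\<tau>\<^sub>0\<close> is
  the strict minimiser for \<open>u\<^sup>* = u\<close>, and by continuity for all \<open>u\<^sup>*\<close> in a neighbourhood of \<open>u\<close>,
  which has positive probability.  So up to probability \<open>\<delta>\<close> each draw detects \<open>\<tau>\<^sub>0\<close> with a conditional
  probability of at least some \<open>q > 0\<close>, and \<open>d\<close> draws all miss it with probability at most \<open>(1 - q)\<^sup>d\<close>.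
\<close>

section \<open>Orthogonal projections\<close>

lemma residual_eq: "residual X \<tau> y = y - hat_matrix X \<tau> *v y"
  by (simp add: residual_def matrix_vector_mult_diff_rdistrib)

lemma linear_hat: "linear ((*v) (hat_matrix X \<tau>))"
  by (rule matrix_vector_mul_linear)

lemma linear_residual: "linear (residual X \<tau>)"
  unfolding residual_def by (rule matrix_vector_mul_linear)

lemma residual_orthogonal:
  assumes "z \<in> column_span X \<tau>"
  shows "residual X \<tau> y \<bullet> z = 0"
  using hat_matrix(2)[OF assms, of y] by (simp add: residual_eq orthogonal_def)

lemma residual_eq_0_iff: "residual X \<tau> y = 0 \<longleftrightarrow> y \<in> column_span X \<tau>"
proof
  assume "residual X \<tau> y = 0"
  then show "y \<in> column_span X \<tau>" using hat_matrix(1)[of X \<tau> y] by (simp add: residual_eq)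
next
  assume "y \<in> column_span X \<tau>"
  then have "residual X \<tau> y \<in> column_span X \<tau>"
    unfolding residual_eq using hat_matrix(1)[of X \<tau> y] by (auto simp: column_span_def intro: span_diff)
  from residual_orthogonal[OF this, of y] show "residual X \<tau> y = 0" by simp
qed

lemma residual_hat [simp]: "residual X \<tau> (hat_matrix X \<tau> *v y) = 0"
  by (simp add: residual_eq_0_iff hat_matrix)

lemma hat_hat [simp]: "hat_matrix X \<tau> *v (hat_matrix X \<tau> *v y) = hat_matrix X \<tau> *v y"
  using residual_hat[of X \<tau> y] unfolding residual_eq by simp

lemma residual_residual [simp]: "residual X \<tau> (residual X \<tau> y) = residual X \<tau> y"
  by (simp add: residual_eq matrix_vector_mult_diff_distrib)

lemma hat_residual [simp]: "hat_matrix X \<tau> *v residual X \<tau> y = 0"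
  by (simp add: residual_eq matrix_vector_mult_diff_distrib)

lemma residual_submodel [simp]: "residual X \<tau> (submodel X \<tau> \<beta>) = 0"
  using range_submodel[of X \<tau>] by (auto simp: residual_eq_0_iff)

text \<open>The arguments \<open>x\<close> and \<open>y\<close> may differ because the two images
  lie in orthogonal subspaces. This freedom later makes a map that mixes two independent Gaussian
  vectors an isometry.\<close>

lemma norm_hat_plus_residual:
  "(norm (hat_matrix X \<tau> *v x + residual X \<tau> y))\<^sup>2 =
     (norm (hat_matrix X \<tau> *v x))\<^sup>2 + (norm (residual X \<tau> y))\<^sup>2"
  using residual_orthogonal[OF hat_matrix(1)[of X \<tau> x], of y]
  by (intro norm_add_Pythagorean) (simp add: orthogonal_def inner_commute)

lemma hat_plus_residual: "hat_matrix X \<tau> *v x + residual X \<tau> x = x"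
  by (simp add: residual_eq)

lemma norm_decomp: "(norm x)\<^sup>2 = (norm (hat_matrix X \<tau> *v x))\<^sup>2 + (norm (residual X \<tau> x))\<^sup>2"
  using norm_hat_plus_residual[of X \<tau> x x] by (simp add: hat_plus_residual)

section \<open>Linear maps and the Gaussian measure\<close>

lemma nn_integral_lborel_add:
  fixes g :: "'a::euclidean_space \<Rightarrow> ennreal"
  assumes [measurable]: "g \<in> borel_measurable borel"
  shows "(\<integral>\<^sup>+x. g (a + x) \<partial>lborel) = (\<integral>\<^sup>+x. g x \<partial>lborel)"
proof -
  have "(\<integral>\<^sup>+x. g x \<partial>lborel) = (\<integral>\<^sup>+x. g x \<partial>distr lborel borel ((+) a))"
    by (simp add: lborel_distr_plus)
  also have "\<dots> = (\<integral>\<^sup>+x. g (a + x) \<partial>lborel)"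
    by (subst nn_integral_distr) auto
  finally show ?thesis ..
qed

text \<open>The image of Lebesgue measure under \<open>f\<close> is translation invariant, hence a
  multiple of Lebesgue measure. Weighting with the unit ball \<open>b\<close> and swapping integrals
  exhibits the factor as \<open>K / m\<close>, the same for all \<open>g\<close>. Where its value
  matters it is found by testing on one \<open>g\<close>, so no determinant is computed.\<close>

lemma nn_integral_lborel_linear_bij:
  fixes f f' :: "'a::euclidean_space \<Rightarrow> 'a"
  assumes f: "linear f" and inv: "\<And>x. f (f' x) = x"
  shows "\<exists>c. \<forall>g\<in>borel_measurable borel. (\<integral>\<^sup>+x. g (f x) \<partial>lborel) = (c::ennreal) * (\<integral>\<^sup>+x. g x \<partial>lborel)"
proof -
  define b :: "'a \<Rightarrow> ennreal" where "b = indicator (cball 0 1)"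
  have [measurable]: "f \<in> borel_measurable borel"
    using f by (simp add: linear_continuous_on linear_linear borel_measurable_continuous_onI)
  have [measurable]: "b \<in> borel_measurable borel" unfolding b_def
    by (intro borel_measurable_indicator borel_closed) simp
  define m where "m = (\<integral>\<^sup>+x. b x \<partial>lborel)"
  define K where "K = (\<integral>\<^sup>+x. b (- f x) \<partial>lborel)"
  have m: "m = emeasure lborel (cball 0 (1::real) :: 'a set)" by (simp add: m_def b_def)
  have "m \<noteq> \<infinity>" unfolding m using emeasure_lborel_cball_finite[of "0::'a" 1] by (simp add: less_top)
  have "m \<noteq> 0"
  proof -
    have "measure lborel (cball (0::'a) 1) \<noteq> 0"
      using content_cball_pos[of 1 "0::'a"] by simp
    then show ?thesis unfolding m measure_def by auto
  qed
  have "(\<integral>\<^sup>+x. g (f x) \<partial>lborel) = K / m * (\<integral>\<^sup>+x. g x \<partial>lborel)"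
    if [measurable]: "g \<in> borel_measurable borel" for g :: "'a \<Rightarrow> ennreal"
  proof -
    have "m * (\<integral>\<^sup>+x. g (f x) \<partial>lborel) = (\<integral>\<^sup>+y. b y * (\<integral>\<^sup>+x. g (f x) \<partial>lborel) \<partial>lborel)"
      by (simp add: m_def nn_integral_multc)
    \<comment> \<open>Translating \<open>x\<close> by \<open>f' y\<close> puts \<open>y\<close> next
      to \<open>f x\<close>, so that after the swap \<open>y\<close> can be translated by
      \<open>- f x\<close>. The same translation of \<open>x\<close> later removes \<open>y\<close>
      from the weight.\<close>
    also have "\<dots> = (\<integral>\<^sup>+y. b y * (\<integral>\<^sup>+x. g (f (f' y + x)) \<partial>lborel) \<partial>lborel)"
      by (subst nn_integral_lborel_add[of "\<lambda>x. g (f x)"]) auto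
    also have "\<dots> = (\<integral>\<^sup>+y. (\<integral>\<^sup>+x. b y * g (y + f x) \<partial>lborel) \<partial>lborel)"
      by (simp add: nn_integral_cmult linear_add[OF f] inv)
    also have "\<dots> = (\<integral>\<^sup>+x. (\<integral>\<^sup>+y. b y * g (y + f x) \<partial>lborel) \<partial>lborel)"
      by (rule lborel_pair.Fubini') measurable
    also have "\<dots> = (\<integral>\<^sup>+x. (\<integral>\<^sup>+y. b (y - f x) * g y \<partial>lborel) \<partial>lborel)"
    proof (rule nn_integral_cong)
      fix x
      show "(\<integral>\<^sup>+y. b y * g (y + f x) \<partial>lborel) = (\<integral>\<^sup>+y. b (y - f x) * g y \<partial>lborel)"
        using nn_integral_lborel_add[of "\<lambda>y. b y * g (y + f x)" "- f x"] by simp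
    qed
    also have "\<dots> = (\<integral>\<^sup>+y. (\<integral>\<^sup>+x. b (y - f x) * g y \<partial>lborel) \<partial>lborel)"
      by (rule lborel_pair.Fubini') measurable
    also have "\<dots> = (\<integral>\<^sup>+y. (\<integral>\<^sup>+x. b (y - f x) \<partial>lborel) * g y \<partial>lborel)"
      by (simp add: nn_integral_multc)
    also have "\<dots> = (\<integral>\<^sup>+y. (\<integral>\<^sup>+x. b (y - f (f' y + x)) \<partial>lborel) * g y \<partial>lborel)"
      by (subst nn_integral_lborel_add[of "\<lambda>x. b (y - f x)" for y]) auto
    also have "\<dots> = K * (\<integral>\<^sup>+y. g y \<partial>lborel)"
      by (simp add: linear_add[OF f] inv K_def nn_integral_cmult)
    finally have eq: "(\<integral>\<^sup>+x. g (f x) \<partial>lborel) * m = (\<integral>\<^sup>+y. g y \<partial>lborel) * K"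
      by (simp add: mult.commute)
    have "(\<integral>\<^sup>+x. g (f x) \<partial>lborel) = (\<integral>\<^sup>+x. g (f x) \<partial>lborel) * m / m"
      using \<open>m \<noteq> 0\<close> \<open>m \<noteq> \<infinity>\<close> by (subst mult_divide_eq_ennreal) auto
    also have "\<dots> = (\<integral>\<^sup>+y. g y \<partial>lborel) * (K / m)"
      unfolding eq by (rule ennreal_times_divide[symmetric])
    finally show ?thesis by (simp only: mult.commute)
  qed
  then show ?thesis by blast
qed

section \<open>The standard normal vector\<close>

text \<open>Once only the norm enters, isometries visibly preserve the weight and orthogonal
  decompositions factor it.\<close>

lemma prod_std_normal_density:
  fixes x :: "real^'n"
  shows "(\<Prod>i\<in>UNIV. std_normal_density (x $ i)) = (1 / sqrt (2 * pi)) ^ CARD('n) * exp (- (norm x)\<^sup>2 / 2)"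
proof -
  have "(norm x)\<^sup>2 = (\<Sum>i\<in>UNIV. (x $ i)\<^sup>2)"
    unfolding power2_norm_eq_inner inner_vec_def by (simp add: power2_eq_square)
  then have "exp (- (norm x)\<^sup>2 / 2) = (\<Prod>i\<in>UNIV. exp (- (x $ i)\<^sup>2 / 2))"
    by (simp add: exp_sum[symmetric] sum_negf sum_divide_distrib)
  then show ?thesis
    by (simp add: std_normal_density_def prod.distrib prod_dividef power_one_over)
qed

lemma space_std_normal_vec [simp]: "space std_normal_vec = UNIV"
  by (simp add: std_normal_vec_def)

lemma sets_std_normal_vec [measurable_cong, simp]: "sets std_normal_vec = sets borel"
  by (simp add: std_normal_vec_def)

lemma prob_space_std_normal_vec: "prob_space (std_normal_vec :: (real^'n) measure)"
proof
  have B: "(\<Prod>b\<in>Basis. g (x \<bullet> b)) = (\<Prod>i\<in>UNIV. g (x $ i))" for g :: "real \<Rightarrow> real" and x :: "real^'n"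
  proof -
    have B: "(Basis :: (real^'n) set) = range (\<lambda>i. axis i 1)" by (auto simp: Basis_vec_def)
    show ?thesis unfolding B
      by (subst prod.reindex) (auto simp: inj_on_def axis_eq_axis inner_axis)
  qed
  have "emeasure std_normal_vec (space (std_normal_vec :: (real^'n) measure)) =
      (\<integral>\<^sup>+x. ennreal (\<Prod>i\<in>UNIV. std_normal_density (x $ i)) \<partial>(lborel :: (real^'n) measure))"
    by (simp add: std_normal_vec_def emeasure_density)
  also have "\<dots> = (\<integral>\<^sup>+x. (\<Prod>b\<in>Basis. ennreal (std_normal_density (x \<bullet> b))) \<partial>(lborel :: (real^'n) measure))"
    by (simp add: B[symmetric] prod_ennreal)
  also have "\<dots> = (\<Prod>b\<in>(Basis :: (real^'n) set). (\<integral>\<^sup>+x. ennreal (std_normal_density x) \<partial>lborel))"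
    by (rule nn_integral_lborel_prod) auto
  also have "(\<integral>\<^sup>+x. ennreal (std_normal_density x) \<partial>lborel) = 1"
    by (subst nn_integral_eq_integral)
       (auto simp: integral_normal_density intro: integrable_normal_density)
  finally show "emeasure std_normal_vec (space (std_normal_vec :: (real^'n) measure)) = 1" by simp
qed

lemma measurable_linear:
  fixes f :: "'a::euclidean_space \<Rightarrow> 'b::euclidean_space"
  shows "linear f \<Longrightarrow> f \<in> borel_measurable borel"
  by (simp add: linear_continuous_on linear_linear borel_measurable_continuous_onI)

lemma measurable_hat [measurable]: "(*v) (hat_matrix X \<tau>) \<in> borel_measurable borel"
  by (rule measurable_linear[OF linear_hat])

lemma measurable_residual [measurable]: "residual X \<tau> \<in> borel_measurable borel"
  by (rule measurable_linear[OF linear_residual])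

text \<open>The Gaussian measure on \<open>\<real>\<^sup>n \<times> \<real>\<^sup>n\<close> is invariant under the isometry
  \<open>(x, y) \<mapsto> (H x + R y, R x + H y)\<close>, where \<open>R = I - H\<close>.\<close>

lemma nn_integral_hat_residual_indep:
  fixes X :: "real^'p^'n" and F :: "(real^'n) \<times> (real^'n) \<Rightarrow> ennreal"
  assumes [measurable]: "F \<in> borel_measurable (borel \<Otimes>\<^sub>M borel)"
  shows "(\<integral>\<^sup>+u. F (hat_matrix X \<tau> *v u, residual X \<tau> u) \<partial>std_normal_vec) =
    (\<integral>\<^sup>+u. (\<integral>\<^sup>+v. F (hat_matrix X \<tau> *v u, residual X \<tau> v) \<partial>std_normal_vec) \<partial>std_normal_vec)"
proof -
  let ?H = "\<lambda>x. hat_matrix X \<tau> *v x" and ?R = "residual X \<tau>"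
  let ?N = "std_normal_vec :: (real^'n) measure"
  define \<phi> where "\<phi> x = ennreal (\<Prod>i\<in>UNIV. std_normal_density (x $ i))" for x :: "real^'n"
  have [measurable]: "\<phi> \<in> borel_measurable borel" unfolding \<phi>_def by measurable
  \<comment> \<open>The hat parts stay in place and the residual parts are exchanged. Exchanging
    twice restores the pair, so \<open>s\<close> serves as its own inverse.\<close>
  define s where "s z = (?H (fst z) + ?R (snd z), ?R (fst z) + ?H (snd z))" for z
  have "linear s"
    by (rule linearI)
       (auto simp: s_def linear_add[OF linear_residual] linear_add[OF linear_hat]
         linear_cmul[OF linear_residual] linear_cmul[OF linear_hat] scaleR_add_right matrix_vector_right_distrib)
  moreover have "s (s z) = z" for z
    by (cases z) (simp add: s_def linear_add[OF linear_residual] linear_add[OF linear_hat] hat_plus_residual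
         add.commute[of "residual X \<tau> _"])
  ultimately obtain c :: ennreal where c: "\<And>g. g \<in> borel_measurable borel \<Longrightarrow>
      (\<integral>\<^sup>+z. g (s z) \<partial>lborel) = c * (\<integral>\<^sup>+z. g z \<partial>lborel)"
    using nn_integral_lborel_linear_bij[of s s] by blast
  have N: "(\<integral>\<^sup>+x. g x \<partial>?N) = (\<integral>\<^sup>+x. \<phi> x * g x \<partial>lborel)"
    if [measurable]: "g \<in> borel_measurable borel" for g :: "real^'n \<Rightarrow> ennreal"
    unfolding std_normal_vec_def \<phi>_def by (subst nn_integral_density) auto
  have \<phi>1: "(\<integral>\<^sup>+x. \<phi> x \<partial>lborel) = 1"
    using prob_space.emeasure_space_1[OF prob_space_std_normal_vec[where 'n='n]] N[of "\<lambda>_. 1"] by simp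
  have \<phi>s: "\<phi> (fst (s z)) * \<phi> (snd (s z)) = \<phi> (fst z) * \<phi> (snd z)" for z
  proof -
    have "(norm (fst (s z)))\<^sup>2 + (norm (snd (s z)))\<^sup>2 = (norm (fst z))\<^sup>2 + (norm (snd z))\<^sup>2"
      using norm_hat_plus_residual[of X \<tau> "fst z" "snd z"] norm_hat_plus_residual[of X \<tau> "snd z" "fst z"]
        norm_decomp[of "fst z" X \<tau>] norm_decomp[of "snd z" X \<tau>]
      by (simp add: s_def add.commute)
    then have "exp (- (norm (fst (s z)))\<^sup>2 / 2) * exp (- (norm (snd (s z)))\<^sup>2 / 2) =
        exp (- (norm (fst z))\<^sup>2 / 2) * exp (- (norm (snd z))\<^sup>2 / 2)"
      by (simp add: exp_add[symmetric] field_simps)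
    then show ?thesis
      by (simp add: \<phi>_def prod_std_normal_density ennreal_mult''[symmetric] mult.assoc mult.left_commute)
  qed
  have pair: "(\<integral>\<^sup>+x. (\<integral>\<^sup>+y. G (x, y) \<partial>lborel) \<partial>lborel) = (\<integral>\<^sup>+z. G z \<partial>lborel)"
    if "G \<in> borel_measurable borel" for G :: "(real^'n) \<times> (real^'n) \<Rightarrow> ennreal"
    using lborel.nn_integral_fst[of G lborel] that by (simp add: lborel_prod)
  have [measurable]: "s \<in> borel_measurable borel" using \<open>linear s\<close> by (rule measurable_linear)
  define G where "G z = \<phi> (fst z) * \<phi> (snd z)" for z
  have [measurable]: "G \<in> borel_measurable borel"
    unfolding G_def borel_prod[symmetric] by measurable
  define g where "g z = G z * F (?H (fst z), ?R (fst z))" for z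
  have [measurable]: "g \<in> borel_measurable borel"
    unfolding g_def G_def borel_prod[symmetric] by measurable
  have G1: "(\<integral>\<^sup>+z. G z \<partial>lborel) = 1"
    using pair[of G] by (simp add: G_def nn_integral_cmult \<phi>1)
  \<comment> \<open>The factor is read off from the Gaussian density, which is invariant under
    \<open>s\<close> and has total mass \<open>1\<close>.\<close>
  have "c = 1" using c[of G] G1 \<phi>s by (simp add: G_def)
  have "(\<integral>\<^sup>+u. F (?H u, ?R u) \<partial>?N) = (\<integral>\<^sup>+x. (\<integral>\<^sup>+y. g (x, y) \<partial>lborel) \<partial>lborel)"
    by (subst N) (auto simp: g_def G_def nn_integral_cmult nn_integral_multc \<phi>1)
  also have "\<dots> = (\<integral>\<^sup>+z. g (s z) \<partial>lborel)" using c[of g] \<open>c = 1\<close> by (simp add: pair)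
  also have "\<dots> = (\<integral>\<^sup>+x. (\<integral>\<^sup>+y. g (s (x, y)) \<partial>lborel) \<partial>lborel)" by (subst pair) auto
  also have "\<dots> = (\<integral>\<^sup>+x. (\<integral>\<^sup>+y. \<phi> x * (\<phi> y * F (?H x, ?R y)) \<partial>lborel) \<partial>lborel)"
    by (simp add: g_def G_def \<phi>s)
       (simp add: s_def linear_add[OF linear_residual] linear_add[OF linear_hat] mult.assoc)
  also have "\<dots> = (\<integral>\<^sup>+u. (\<integral>\<^sup>+v. F (?H u, ?R v) \<partial>?N) \<partial>?N)"
    by (subst (1 2) N) (auto simp: nn_integral_cmult)
  finally show ?thesis .
qed

section \<open>Null sets and open sets under the Gaussian measure\<close>

lemma null_sets_std_normal_vec:
  fixes A :: "(real^'n) set"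
  assumes "A \<in> sets borel"
  shows "A \<in> null_sets std_normal_vec \<longleftrightarrow> A \<in> null_sets lborel"
proof -
  have "0 < (\<Prod>i\<in>UNIV. std_normal_density (x $ i))" for x :: "real^'n"
    by (intro prod_pos) (auto simp: normal_density_pos)
  then have "ennreal (\<Prod>i\<in>UNIV. std_normal_density (x $ i)) \<noteq> 0" for x :: "real^'n"
    by (metis ennreal_eq_0_iff not_le)
  then have "A \<in> null_sets std_normal_vec \<longleftrightarrow> A \<in> sets borel \<and> (AE x in lborel. x \<notin> A)"
    unfolding std_normal_vec_def by (subst null_sets_density_iff) auto
  then show ?thesis using assms by (auto simp: AE_iff_null_sets)
qed

lemma AE_not_in_proper_subspace:
  fixes S :: "(real^'n) set"
  assumes "dim S < CARD('n)"
  shows "AE x in std_normal_vec. x \<notin> span S"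
proof -
  have "dim (span S) < DIM(real^'n)" using assms by (simp add: dim_span)
  then have "negligible (span S)" by (rule negligible_lowdim)
  then have "span S \<in> null_sets lebesgue" by (simp add: negligible_iff_null_sets)
  moreover have "span S \<in> sets borel" by (intro borel_closed closed_span)
  ultimately have "span S \<in> null_sets std_normal_vec"
    by (simp add: null_sets_std_normal_vec null_sets_completion_iff)
  then show ?thesis by (rule AE_not_in)
qed

lemma AE_residual_nonzero:
  fixes X :: "real^'p^'n"
  assumes "card \<tau> < CARD('n)"
  shows "AE x in std_normal_vec. residual X \<tau> x \<noteq> 0"
proof -
  have "dim ((\<lambda>j. column j X) ` \<tau>) \<le> card ((\<lambda>j. column j X) ` \<tau>)"
    by (rule dim_le_card') simp
  also have "\<dots> \<le> card \<tau>" by (rule card_image_le) simp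
  finally have "AE x in std_normal_vec. x \<notin> span ((\<lambda>j. column j X) ` \<tau>)"
    using assms by (intro AE_not_in_proper_subspace) simp
  then show ?thesis by (simp add: residual_eq_0_iff column_span_def)
qed

lemma open_std_normal_vec_pos:
  fixes A :: "(real^'n) set"
  assumes "open A" "A \<noteq> {}"
  shows "emeasure std_normal_vec A > 0"
proof -
  have "A \<notin> null_sets lborel"
    using open_not_negligible[OF assms] assms(1) by (simp add: negligible_iff_null_sets null_sets_completion_iff)
  then have "A \<notin> null_sets std_normal_vec"
    using assms(1) by (simp add: null_sets_std_normal_vec)
  then show ?thesis using assms(1) by (auto simp: null_sets_def zero_less_iff_neq_zero)
qed

text \<open>For fixed \<open>B\<close>, the measure \<open>\<nu> B\<close> of \<open>\<bar>R u\<bar>\<close> on the event \<open>R u / \<bar>R u\<bar> \<in> B\<close>, with the Gaussian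
  weight kept only on the component \<open>H u\<close>, is homogeneous under the dilations \<open>u \<mapsto> H u + b R u\<close>.  Hence
  all \<open>\<nu> B\<close> are proportional to each other.\<close>

lemma emeasure_norm_direction_indep:
  fixes X :: "real^'p^'n"
  assumes A: "A \<in> sets borel" and B: "B \<in> sets borel" and \<tau>: "card \<tau> < CARD('n)"
  shows "emeasure std_normal_vec {v. norm (residual X \<tau> v) \<in> A \<and>
            residual X \<tau> v /\<^sub>R norm (residual X \<tau> v) \<in> B} =
    emeasure std_normal_vec {v. norm (residual X \<tau> v) \<in> A} *
    emeasure std_normal_vec {v. residual X \<tau> v /\<^sub>R norm (residual X \<tau> v) \<in> B}"
proof -
  let ?H = "\<lambda>x. hat_matrix X \<tau> *v x" and ?R = "residual X \<tau>"
  let ?N = "std_normal_vec :: (real^'n) measure"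
  define dir where "dir v = ?R v /\<^sub>R norm (?R v)" for v
  have [measurable]: "dir \<in> borel_measurable borel" unfolding dir_def by measurable
  define k where "k = (1 / sqrt (2 * pi)) ^ CARD('n)"
  have k: "k > 0" by (simp add: k_def)
  define w where "w B u = ennreal (indicator B (dir u) * exp (- (norm (?H u))\<^sup>2 / 2))" for B u
  have [measurable]: "w B \<in> borel_measurable borel" if [measurable]: "B \<in> sets borel" for B
    unfolding w_def by measurable
  define \<nu> where "\<nu> B = distr (density lborel (w B)) borel (\<lambda>u. norm (?R u))" for B
  have [simp, measurable_cong]: "sets (\<nu> B) = sets borel" for B by (simp add: \<nu>_def)
  have \<nu>: "emeasure (\<nu> B) S = (\<integral>\<^sup>+u. w B u * indicator S (norm (?R u)) \<partial>lborel)"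
    if [measurable]: "B \<in> sets borel" "S \<in> sets borel" for B S
  proof -
    have "(\<lambda>u. norm (?R u)) -` S \<in> sets borel" using measurable_sets[of "\<lambda>u. norm (?R u)" borel borel S] by simp
    then show ?thesis
      unfolding \<nu>_def by (subst emeasure_distr) (auto simp: emeasure_density indicator_def intro!: nn_integral_cong)
  qed
  have R0: "AE u in lborel. ?R u \<noteq> 0"
  proof -
    have [measurable]: "{u. ?R u = 0} \<in> sets borel" by measurable
    have "{u. ?R u = 0} \<in> null_sets ?N"
      using AE_residual_nonzero[OF \<tau>, of X] by (subst AE_iff_null_sets) auto
    then have "{u. ?R u = 0} \<in> null_sets lborel" by (simp add: null_sets_std_normal_vec)
    from AE_not_in[OF this] show ?thesis by simp
  qed
  have N: "(\<integral>\<^sup>+x. g x \<partial>?N) = (\<integral>\<^sup>+x. ennreal (k * exp (- (norm x)\<^sup>2 / 2)) * g x \<partial>lborel)"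
    if [measurable]: "g \<in> borel_measurable borel" for g :: "real^'n \<Rightarrow> ennreal"
    unfolding std_normal_vec_def prod_std_normal_density k_def by (subst nn_integral_density) auto
  have N1: "emeasure ?N UNIV = 1"
    using prob_space.emeasure_space_1[OF prob_space_std_normal_vec[where 'n='n]] by simp
  \<comment> \<open>The factor \<open>c\<close> may depend on \<open>b\<close> but serves all
    \<open>B\<close> at once; this uniformity is what makes the measures \<open>\<nu> B\<close>
    proportional.\<close>
  have hom: "\<exists>c. \<forall>B\<in>sets borel. emeasure (\<nu> B) {..b} = c * emeasure (\<nu> B) {..1}" for b
  proof (cases "b > 0")
    case False
    \<comment> \<open>A residual norm of at most \<open>b \<le> 0\<close> forces the residual to
      vanish, which happens on a null set only.\<close>
    have "emeasure (\<nu> B) {..b} = 0" if [measurable]: "B \<in> sets borel" for B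
    proof -
      have "(\<integral>\<^sup>+u. w B u * indicator {..b} (norm (?R u)) \<partial>lborel) = (\<integral>\<^sup>+u. 0 \<partial>(lborel :: (real^'n) measure))"
        using R0 False
        by (intro nn_integral_cong_AE) (auto elim!: eventually_mono simp: indicator_def not_less dest: order_trans)
      then show ?thesis by (simp add: \<nu>)
    qed
    then show ?thesis by (intro exI[of _ 0]) simp
  next
    case True
    \<comment> \<open>Rescaling the residual part turns the radius bound \<open>b\<close> into
      \<open>1\<close> and changes neither the hat part nor the direction, so \<open>w B\<close> is
      invariant under \<open>D\<close>.\<close>
    define D where "D u = ?H u + (1 / b) *\<^sub>R ?R u" for u
    have D: "linear D"
      unfolding D_def by (intro linear_compose_add linear_compose_scale_right linear_hat linear_residual)
    have HD: "?H (D u) = ?H u" and RD: "?R (D u) = (1 / b) *\<^sub>R ?R u" for u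
      by (simp_all add: D_def linear_add[OF linear_residual] linear_add[OF linear_hat]
         linear_cmul[OF linear_residual] linear_cmul[OF linear_hat])
    have "D (?H u + b *\<^sub>R ?R u) = u" for u
      using True by (simp add: D_def linear_add[OF linear_residual] linear_add[OF linear_hat]
         linear_cmul[OF linear_residual] linear_cmul[OF linear_hat] hat_plus_residual)
    from nn_integral_lborel_linear_bij[OF D this] obtain c :: ennreal where
      c: "\<And>g. g \<in> borel_measurable borel \<Longrightarrow> (\<integral>\<^sup>+u. g (D u) \<partial>lborel) = c * (\<integral>\<^sup>+u. g u \<partial>lborel)"
      by blast
    have "emeasure (\<nu> B) {..b} = c * emeasure (\<nu> B) {..1}" if [measurable]: "B \<in> sets borel" for B
    proof -
      have "w B u * indicator {..b} (norm (?R u)) = w B (D u) * indicator {..1} (norm (?R (D u)))" for u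
        using True by (simp add: w_def dir_def HD RD indicator_def field_simps)
      then have "emeasure (\<nu> B) {..b} = (\<integral>\<^sup>+u. w B (D u) * indicator {..1} (norm (?R (D u))) \<partial>lborel)"
        by (simp add: \<nu>)
      also have "\<dots> = c * (\<integral>\<^sup>+u. w B u * indicator {..1} (norm (?R u)) \<partial>lborel)"
        by (rule c) measurable
      finally show ?thesis by (simp add: \<nu>)
    qed
    then show ?thesis by blast
  qed
  \<comment> \<open>On a bounded range of radii the Gaussian factor missing from \<open>w\<close> is
    at least \<open>exp (- b\<^sup>2 / 2)\<close>, so restoring it costs a constant and leaves an
    integral of total mass \<open>1\<close>.\<close>
  have fin: "emeasure (\<nu> B) {..b} < \<infinity>" if [measurable]: "B \<in> sets borel" for B b
  proof -
    have "emeasure (\<nu> B) {..b} \<le> (\<integral>\<^sup>+u. ennreal (exp (b\<^sup>2 / 2) / k) * (ennreal (k * exp (- (norm u)\<^sup>2 / 2)) * 1) \<partial>(lborel :: (real^'n) measure))"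
      unfolding \<nu>[OF that borel_closed[OF closed_atMost]]
    proof (rule nn_integral_mono)
      fix u
      have "exp (- (norm (?H u))\<^sup>2 / 2) \<le> exp (b\<^sup>2 / 2) / k * (k * exp (- (norm u)\<^sup>2 / 2))" if "norm (?R u) \<le> b"
      proof -
        have "(norm (?R u))\<^sup>2 \<le> b\<^sup>2" using that by (intro power_mono) auto
        then have "exp (- (norm (?H u))\<^sup>2 / 2) \<le> exp (b\<^sup>2 / 2 + - (norm u)\<^sup>2 / 2)"
          using norm_decomp[of u X \<tau>] by (simp add: field_simps)
        also have "\<dots> = exp (b\<^sup>2 / 2) / k * (k * exp (- (norm u)\<^sup>2 / 2))" unfolding exp_add using k by simp
        finally show ?thesis .
      qed
      then show "w B u * indicator {..b} (norm (?R u)) \<le>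
          ennreal (exp (b\<^sup>2 / 2) / k) * (ennreal (k * exp (- (norm u)\<^sup>2 / 2)) * 1)"
        using k by (auto simp: w_def indicator_def ennreal_mult''[symmetric])
    qed
    also have "\<dots> = ennreal (exp (b\<^sup>2 / 2) / k)"
      using N[of "\<lambda>_. 1"] N1 by (simp add: nn_integral_cmult)
    finally show ?thesis by (simp add: le_less_trans)
  qed
  define a where "a = emeasure (\<nu> UNIV) {..1}"
  \<comment> \<open>Proportionality in cross-multiplied form, which avoids a division in the
    extended reals. Half lines are stable under intersection, generate the Borel sets and exhaust
    the line with finite mass.\<close>
  have scaled: "scale_measure a (\<nu> B) = scale_measure (emeasure (\<nu> B) {..1}) (\<nu> UNIV)"
    if [measurable]: "B \<in> sets borel" for B
  proof (rule measure_eqI_generator_eq[where E="range atMost" and \<Omega>=UNIV and A="\<lambda>i. {..real i}"])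
    show "Int_stable (range (atMost :: real \<Rightarrow> _))" by (auto simp: Int_stable_def)
    show "emeasure (scale_measure a (\<nu> B)) S =
        emeasure (scale_measure (emeasure (\<nu> B) {..1}) (\<nu> UNIV)) S" if "S \<in> range atMost" for S :: "real set"
    proof -
      obtain b where S: "S = {..b}" using \<open>S \<in> range atMost\<close> by (rule rangeE)
      from hom[of b] obtain c where "\<forall>B\<in>sets borel. emeasure (\<nu> B) {..b} = c * emeasure (\<nu> B) {..1}" by auto
      then show ?thesis using \<open>B \<in> sets borel\<close> by (simp add: S a_def ac_simps)
    qed
    show "sets (scale_measure a (\<nu> B)) = sigma_sets UNIV (range atMost)"
      "sets (scale_measure (emeasure (\<nu> B) {..1}) (\<nu> UNIV)) = sigma_sets UNIV (range atMost)"
      unfolding sets_scale_measure by (simp_all, simp_all add: borel_eq_atMost)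
    show "(\<Union>i. {..real i}) = UNIV" using real_arch_simple by auto
    show "emeasure (scale_measure a (\<nu> B)) {..real i} \<noteq> \<infinity>" for i
      using fin[of B "real i"] fin[of UNIV 1] by (simp add: a_def ennreal_mult_eq_top_iff less_top)
  qed auto
  \<comment> \<open>The Gaussian factor of the residual returns here as a function of the radius
    alone, so that the direction enters only through \<open>\<nu> B\<close>.\<close>
  have \<nu>N: "emeasure ?N {v. norm (?R v) \<in> A \<and> dir v \<in> B} =
      (\<integral>\<^sup>+r. ennreal (k * exp (- r\<^sup>2 / 2)) * indicator A r \<partial>\<nu> B)"
    if [measurable]: "A \<in> sets borel" "B \<in> sets borel" for A B
  proof -
    have "emeasure ?N {v. norm (?R v) \<in> A \<and> dir v \<in> B} =
        (\<integral>\<^sup>+v. indicator {v. norm (?R v) \<in> A \<and> dir v \<in> B} v \<partial>?N)" by simp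
    also have "\<dots> = (\<integral>\<^sup>+v. ennreal (k * exp (- (norm v)\<^sup>2 / 2)) * indicator {v. norm (?R v) \<in> A \<and> dir v \<in> B} v \<partial>lborel)"
      by (rule N) measurable
    also have "\<dots> = (\<integral>\<^sup>+v. w B v * (ennreal (k * exp (- (norm (?R v))\<^sup>2 / 2)) * indicator A (norm (?R v))) \<partial>lborel)"
    proof (rule nn_integral_cong)
      fix v
      have "exp (- (norm v)\<^sup>2 / 2) = exp (- (norm (?H v))\<^sup>2 / 2) * exp (- (norm (?R v))\<^sup>2 / 2)"
        by (subst norm_decomp[of v X \<tau>]) (simp add: exp_add[symmetric] field_simps)
      then show "ennreal (k * exp (- (norm v)\<^sup>2 / 2)) * indicator {v. norm (?R v) \<in> A \<and> dir v \<in> B} v =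
          w B v * (ennreal (k * exp (- (norm (?R v))\<^sup>2 / 2)) * indicator A (norm (?R v)))"
        using k by (auto simp: w_def indicator_def ennreal_mult''[symmetric] ac_simps)
    qed
    also have "\<dots> = (\<integral>\<^sup>+r. ennreal (k * exp (- r\<^sup>2 / 2)) * indicator A r \<partial>\<nu> B)"
      unfolding \<nu>_def by (subst nn_integral_distr, simp, measurable) (subst nn_integral_density, auto)
    finally show ?thesis .
  qed
  have key: "a * emeasure ?N {v. norm (?R v) \<in> A \<and> dir v \<in> B} =
      emeasure (\<nu> B) {..1} * emeasure ?N {v. norm (?R v) \<in> A}"
    if [measurable]: "A \<in> sets borel" "B \<in> sets borel" for A B
  proof -
    let ?f = "\<lambda>r. ennreal (k * exp (- r\<^sup>2 / 2)) * indicator A r"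
    have "a * integral\<^sup>N (\<nu> B) ?f = integral\<^sup>N (scale_measure a (\<nu> B)) ?f"
      by (subst nn_integral_scale_measure) auto
    also have "\<dots> = emeasure (\<nu> B) {..1} * integral\<^sup>N (\<nu> UNIV) ?f"
      unfolding scaled[OF that(2)] by (subst nn_integral_scale_measure) auto
    finally show ?thesis using \<nu>N[of A B] \<nu>N[of A UNIV] by simp
  qed
  \<comment> \<open>If \<open>a\<close> were \<open>0\<close>, homogeneity would make every half
    line null, and the Gaussian measure itself would have mass \<open>0\<close>.\<close>
  have "a \<noteq> 0"
  proof
    assume "a = 0"
    have "emeasure (\<nu> UNIV) {..real i} = 0" for i
      using hom[of "real i"] \<open>a = 0\<close> by (auto simp: a_def)
    then have "(\<Union>i. {..real i}) \<in> null_sets (\<nu> UNIV)"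
      by (intro null_sets_UN) (auto simp: null_sets_def)
    moreover have "(\<Union>i. {..real i}) = UNIV" using real_arch_simple by auto
    ultimately have "UNIV \<in> null_sets (\<nu> UNIV)" by simp
    from AE_not_in[OF this] have "AE r in \<nu> UNIV. False" by simp
    then have "(\<integral>\<^sup>+r. ennreal (k * exp (- r\<^sup>2 / 2)) * indicator UNIV r \<partial>\<nu> UNIV) = (\<integral>\<^sup>+r. 0 \<partial>\<nu> UNIV)"
      by (intro nn_integral_cong_AE) auto
    then show False using \<nu>N[of UNIV UNIV] N1 by simp
  qed
  have "a \<noteq> \<infinity>" using fin[of UNIV 1] by (simp add: a_def less_top)
  \<comment> \<open>Taking \<open>UNIV\<close> for the set of radii identifies the proportionality
    factor as the probability of the direction event.\<close>
  have "emeasure (\<nu> B) {..1} = a * emeasure ?N {v. dir v \<in> B}"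
    using key[OF _ B, of UNIV] N1 by simp
  then have "a * emeasure ?N {v. norm (?R v) \<in> A \<and> dir v \<in> B} =
      a * (emeasure ?N {v. norm (?R v) \<in> A} * emeasure ?N {v. dir v \<in> B})"
    unfolding key[OF A B] by (simp only: mult.assoc mult.commute[of "emeasure ?N {v. norm (?R v) \<in> A}"])
  then show ?thesis
    using \<open>a \<noteq> 0\<close> \<open>a \<noteq> \<infinity>\<close> by (simp add: dir_def ennreal_mult_cancel_left)
qed

section \<open>Conditional coverage\<close>

text \<open>Over a finite index type the set of minimisers takes finitely many values, each on a
  finite Boolean combination of comparisons. On this discrete space any selection \<open>tb\<close>
  is measurable.\<close>

lemma measurable_tie_breaking_arg_min [measurable (raw)]:
  fixes f :: "'i::finite \<Rightarrow> 'a \<Rightarrow> real"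
  assumes [measurable]: "\<And>i. f i \<in> borel_measurable M"
  shows "(\<lambda>x. tb {i. is_arg_min (\<lambda>i. f i x) P i}) \<in> measurable M (count_space UNIV)"
proof (rule measurable_compose[where g=tb])
  show "(\<lambda>x. {i. is_arg_min (\<lambda>i. f i x) P i}) \<in> measurable M (count_space UNIV)"
  proof (subst measurable_count_space_eq2, simp, intro conjI ballI)
    fix S :: "'i set"
    have "(\<lambda>x. {i. is_arg_min (\<lambda>i. f i x) P i}) -` {S} \<inter> space M =
        {x \<in> space M. \<forall>i\<in>UNIV. (P i \<and> \<not> (\<exists>j\<in>UNIV. P j \<and> f j x < f i x)) = (i \<in> S)}"
      by (auto simp: is_arg_min_def set_eq_iff)
    also have "\<dots> \<in> sets M" by measurable
    finally show "(\<lambda>x. {i. is_arg_min (\<lambda>i. f i x) P i}) -` {S} \<inter> space M \<in> sets M" .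
  qed simp
qed simp

lemma measurable_T_tilde [measurable]:
  "(\<lambda>y. T_tilde tb X y \<tau>) \<in> measurable borel (count_space UNIV)"
  unfolding T_tilde_def rss_eq by measurable

lemma measurable_cond_pmf [measurable]:
  fixes X :: "real^'p^'n"
  shows "(\<lambda>w. cond_pmf tb X w \<tau> \<tau>') \<in> borel_measurable (borel \<Otimes>\<^sub>M borel)"
proof -
  interpret N: prob_space "std_normal_vec :: (real^'n) measure" by (rule prob_space_std_normal_vec)
  define Q where "Q = {z \<in> space ((borel \<Otimes>\<^sub>M borel) \<Otimes>\<^sub>M (std_normal_vec :: (real^'n) measure)).
    T_tilde tb X (fst (fst z) + snd (fst z) *\<^sub>R (residual X \<tau> (snd z) /\<^sub>R norm (residual X \<tau> (snd z)))) \<tau> = \<tau>'}"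
  have "Q \<in> sets ((borel \<Otimes>\<^sub>M borel) \<Otimes>\<^sub>M (std_normal_vec :: (real^'n) measure))"
    unfolding Q_def by measurable
  from N.measurable_emeasure_Pair[OF this]
  have "(\<lambda>w. enn2real (emeasure std_normal_vec (Pair w -` Q))) \<in> borel_measurable (borel \<Otimes>\<^sub>M borel)"
    by measurable
  moreover have "Pair w -` Q = {v. T_tilde tb X (fst w + snd w *\<^sub>R
      (residual X \<tau> v /\<^sub>R norm (residual X \<tau> v))) \<tau> = \<tau>'}" for w
    by (auto simp: Q_def space_pair_measure)
  ultimately show ?thesis by (simp add: cond_pmf_def measure_def)
qed

lemma pred_B_set [measurable]:
  "Measurable.pred (borel \<Otimes>\<^sub>M borel) (\<lambda>w. \<tau>s \<in> B_set tb X \<alpha> \<tau> w)"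
proof -
  have "\<tau>s \<in> B_set tb X \<alpha> \<tau> w \<longleftrightarrow> 1 - \<alpha> \<le>
      (\<Sum>\<tau>'\<in>UNIV. if cond_pmf tb X w \<tau> \<tau>' \<le> cond_pmf tb X w \<tau> \<tau>s then cond_pmf tb X w \<tau> \<tau>' else 0)" for w
    by (simp add: B_set_def sum.If_cases)
  then show ?thesis by simp
qed

text \<open>The complement of the set below is a lower level set of \<open>p\<close>; its mass is read off at the
  element with the largest \<open>p\<close>.\<close>

lemma sum_highest_density_ge:
  fixes p :: "'i::finite \<Rightarrow> real"
  assumes nn: "\<And>i. 0 \<le> p i" and 1: "(\<Sum>i\<in>UNIV. p i) = 1" and "\<alpha> \<le> 1"
  shows "\<alpha> \<le> (\<Sum>i | 1 - \<alpha> \<le> (\<Sum>j | p j \<le> p i. p j). p i)"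
proof -
  let ?L = "\<lambda>i. \<Sum>j | p j \<le> p i. p j"
  define C where "C = {i. ?L i < 1 - \<alpha>}"
  have "sum p C \<le> 1 - \<alpha>"
  proof (cases "C = {}")
    case False
    then obtain i where i: "i \<in> C" "\<And>j. j \<in> C \<Longrightarrow> p j \<le> p i"
      using finite_imageI[of C p] Max_in[of "p ` C"] Max_ge[of "p ` C"] by fastforce
    have "sum p C \<le> ?L i" by (intro sum_mono2) (auto simp: nn i)
    then show ?thesis using i(1) by (simp add: C_def)
  qed (use assms in simp)
  moreover have "{i. 1 - \<alpha> \<le> ?L i} = - C" by (auto simp: C_def)
  moreover have "sum p C + sum p (- C) = 1"
    using sum.union_disjoint[of C "- C" p] 1 by simp
  ultimately show ?thesis by simp
qed

section \<open>Replacing the residual direction by an independent copy\<close>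

text \<open>Independence on rectangles identifies the joint law of radius and direction with the
  product of the marginal laws; the iterated integral is then Fubini.\<close>

lemma nn_integral_norm_direction_indep:
  fixes X :: "real^'p^'n" and F :: "real \<times> (real^'n) \<Rightarrow> ennreal"
  assumes [measurable]: "F \<in> borel_measurable (borel \<Otimes>\<^sub>M borel)" and \<tau>: "card \<tau> < CARD('n)"
  shows "(\<integral>\<^sup>+v. F (norm (residual X \<tau> v), residual X \<tau> v /\<^sub>R norm (residual X \<tau> v)) \<partial>std_normal_vec) =
    (\<integral>\<^sup>+v. (\<integral>\<^sup>+w. F (norm (residual X \<tau> v), residual X \<tau> w /\<^sub>R norm (residual X \<tau> w)) \<partial>std_normal_vec)
      \<partial>std_normal_vec)"
proof -
  let ?N = "std_normal_vec :: (real^'n) measure"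
  let ?r = "\<lambda>v. norm (residual X \<tau> v)" and ?e = "\<lambda>v. residual X \<tau> v /\<^sub>R norm (residual X \<tau> v)"
  interpret N: prob_space ?N by (rule prob_space_std_normal_vec)
  interpret r: prob_space "distr ?N borel ?r" by (rule N.prob_space_distr) measurable
  interpret e: prob_space "distr ?N borel ?e" by (rule N.prob_space_distr) measurable
  have eq: "distr ?N borel ?r \<Otimes>\<^sub>M distr ?N borel ?e = distr ?N (borel \<Otimes>\<^sub>M borel) (\<lambda>v. (?r v, ?e v))"
  proof (rule pair_measure_eqI)
    fix A B assume "A \<in> sets (distr ?N borel ?r)" "B \<in> sets (distr ?N borel ?e)"
    then have [measurable]: "A \<in> sets borel" "B \<in> sets borel" by auto
    have "emeasure (distr ?N borel ?r) A * emeasure (distr ?N borel ?e) B =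
        emeasure ?N {v. ?r v \<in> A} * emeasure ?N {v. ?e v \<in> B}"
      by (simp add: emeasure_distr vimage_def)
    also have "\<dots> = emeasure ?N {v. ?r v \<in> A \<and> ?e v \<in> B}"
      by (rule emeasure_norm_direction_indep[symmetric]) (use \<tau> in auto)
    also have "\<dots> = emeasure (distr ?N (borel \<Otimes>\<^sub>M borel) (\<lambda>v. (?r v, ?e v))) (A \<times> B)"
      by (simp add: emeasure_distr vimage_def)
    finally show "emeasure (distr ?N borel ?r) A * emeasure (distr ?N borel ?e) B =
      emeasure (distr ?N (borel \<Otimes>\<^sub>M borel) (\<lambda>v. (?r v, ?e v))) (A \<times> B)" .
  qed (auto simp: r.sigma_finite_measure_axioms e.sigma_finite_measure_axioms cong: sets_pair_measure_cong)
  have "(\<integral>\<^sup>+v. F (?r v, ?e v) \<partial>?N) = (\<integral>\<^sup>+z. F z \<partial>(distr ?N borel ?r \<Otimes>\<^sub>M distr ?N borel ?e))"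
    unfolding eq by (subst nn_integral_distr) auto
  also have "\<dots> = (\<integral>\<^sup>+a. (\<integral>\<^sup>+b. F (a, b) \<partial>distr ?N borel ?e) \<partial>distr ?N borel ?r)"
    by (subst e.nn_integral_fst) auto
  also have "\<dots> = (\<integral>\<^sup>+v. (\<integral>\<^sup>+b. F (?r v, b) \<partial>distr ?N borel ?e) \<partial>?N)"
    by (subst nn_integral_distr) auto
  also have "\<dots> = (\<integral>\<^sup>+v. (\<integral>\<^sup>+w. F (?r v, ?e w) \<partial>?N) \<partial>?N)"
    by (intro nn_integral_cong, subst nn_integral_distr) auto
  finally show ?thesis .
qed

text \<open>First the residual is detached from the hat part as a copy \<open>v\<close>, then its
  direction is detached from its radius as a copy \<open>w\<close>. The first identity read
  backwards finally reunites hat part and radius in a single vector.\<close>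

lemma nn_integral_W_direction_indep:
  fixes X :: "real^'p^'n" and F :: "((real^'n) \<times> real) \<times> (real^'n) \<Rightarrow> ennreal"
  assumes [measurable]: "F \<in> borel_measurable ((borel \<Otimes>\<^sub>M borel) \<Otimes>\<^sub>M borel)" and \<tau>: "card \<tau> < CARD('n)"
  shows "(\<integral>\<^sup>+u. F (W_tilde X u \<tau>, residual X \<tau> u /\<^sub>R norm (residual X \<tau> u)) \<partial>std_normal_vec) =
    (\<integral>\<^sup>+u. (\<integral>\<^sup>+v. F (W_tilde X u \<tau>, residual X \<tau> v /\<^sub>R norm (residual X \<tau> v)) \<partial>std_normal_vec)
      \<partial>std_normal_vec)"
proof -
  let ?N = "std_normal_vec :: (real^'n) measure"
  let ?H = "\<lambda>u. hat_matrix X \<tau> *v u" and ?R = "residual X \<tau>"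
  let ?e = "\<lambda>v. ?R v /\<^sub>R norm (?R v)"
  interpret N: prob_space ?N by (rule prob_space_std_normal_vec)
  have [measurable]: "(\<lambda>z. \<integral>\<^sup>+w. F ((fst z, norm (snd z)), ?e w) \<partial>?N) \<in> borel_measurable (borel \<Otimes>\<^sub>M borel)"
    by measurable
  have "(\<integral>\<^sup>+u. F ((?H u, norm (?R u)), ?e u) \<partial>?N) = (\<integral>\<^sup>+u. (\<integral>\<^sup>+v. F ((?H u, norm (?R v)), ?e v) \<partial>?N) \<partial>?N)"
    using nn_integral_hat_residual_indep[of "\<lambda>z. F ((fst z, norm (snd z)), snd z /\<^sub>R norm (snd z))" X \<tau>]
    by simp
  also have "\<dots> = (\<integral>\<^sup>+u. (\<integral>\<^sup>+v. (\<integral>\<^sup>+w. F ((?H u, norm (?R v)), ?e w) \<partial>?N) \<partial>?N) \<partial>?N)"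
  proof (rule nn_integral_cong)
    fix u
    show "(\<integral>\<^sup>+v. F ((?H u, norm (?R v)), ?e v) \<partial>?N) =
        (\<integral>\<^sup>+v. (\<integral>\<^sup>+w. F ((?H u, norm (?R v)), ?e w) \<partial>?N) \<partial>?N)"
      using nn_integral_norm_direction_indep[of "\<lambda>z. F ((?H u, fst z), snd z)" \<tau> X] \<tau> by simp
  qed
  also have "\<dots> = (\<integral>\<^sup>+u. (\<integral>\<^sup>+w. F ((?H u, norm (?R u)), ?e w) \<partial>?N) \<partial>?N)"
    using nn_integral_hat_residual_indep[of "\<lambda>z. \<integral>\<^sup>+w. F ((fst z, norm (snd z)), ?e w) \<partial>?N" X \<tau>] by simp
  finally show ?thesis by (simp add: W_tilde_def)
qed

lemma measurable_W_tilde [measurable]: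
  "(\<lambda>y. W_tilde X y \<tau>) \<in> measurable borel (borel \<Otimes>\<^sub>M borel)"
  unfolding W_tilde_def by measurable

text \<open>A finite disjunction over the values of \<open>T_tilde\<close> separates the random
  element from the random set.\<close>

lemma pred_T_tilde_in_B_set:
  "Measurable.pred ((borel \<Otimes>\<^sub>M borel) \<Otimes>\<^sub>M borel)
     (\<lambda>(w, y). T_tilde tb X y \<tau> \<in> B_set tb X \<alpha> \<tau> w)"
proof -
  have "(\<lambda>(w, y). T_tilde tb X y \<tau> \<in> B_set tb X \<alpha> \<tau> w) =
      (\<lambda>z. \<exists>s\<in>UNIV. T_tilde tb X (snd z) \<tau> = s \<and> s \<in> B_set tb X \<alpha> \<tau> (fst z))" by auto
  then show ?thesis by simp
qed

lemma pred_coverage [measurable]: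
  "Measurable.pred borel (\<lambda>y. T_tilde tb X y \<tau> \<in> B_set tb X \<alpha> \<tau> (W_tilde X y \<tau>))"
proof -
  have [measurable]: "Measurable.pred borel (\<lambda>y. s \<in> B_set tb X \<alpha> \<tau> (W_tilde X y \<tau>))" for s
    by (rule measurable_compose[OF measurable_W_tilde pred_B_set])
  have "(\<lambda>y. T_tilde tb X y \<tau> \<in> B_set tb X \<alpha> \<tau> (W_tilde X y \<tau>)) =
      (\<lambda>y. \<exists>s\<in>UNIV. T_tilde tb X y \<tau> = s \<and> s \<in> B_set tb X \<alpha> \<tau> (W_tilde X y \<tau>))" by auto
  also have "Measurable.pred borel \<dots>" by measurable
  finally show ?thesis .
qed

text \<open>For each fixed value of \<open>W_tilde\<close> an independent direction gives the
  statistic exactly the law \<open>cond_pmf\<close>, so the bound on highest density sets applies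
  pointwise. Averaging and undoing the replacement by an independent copy gives the unconditional
  bound.\<close>

lemma emeasure_coverage:
  fixes X :: "real^'p^'n"
  assumes \<mu>: "\<mu> \<in> column_span X \<tau>" and \<sigma>: "\<sigma> > 0" and \<tau>: "card \<tau> < CARD('n)" and \<alpha>: "0 \<le> \<alpha>" "\<alpha> \<le> 1"
  defines "y \<equiv> \<lambda>u. \<mu> + \<sigma> *\<^sub>R u"
  shows "ennreal \<alpha> \<le> emeasure std_normal_vec
    {u. T_tilde tb X (y u) \<tau> \<in> B_set tb X \<alpha> \<tau> (W_tilde X (y u) \<tau>)}"
proof -
  let ?N = "std_normal_vec :: (real^'n) measure"
  let ?e = "\<lambda>v. residual X \<tau> v /\<^sub>R norm (residual X \<tau> v)"
  interpret N: prob_space ?N by (rule prob_space_std_normal_vec)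
  define t where "t w e = T_tilde tb X (fst w + snd w *\<^sub>R e) \<tau>" for w e
  \<comment> \<open>\<open>V\<close> carries the pair computed from the noise to the pair computed
    from the data: \<mu> is fixed by the projection, and a positive \<open>\<sigma>\<close> scales
    the residual norm.\<close>
  define V where "V w = (\<mu> + \<sigma> *\<^sub>R fst w, \<sigma> * snd w)" for w :: "(real^'n) \<times> real"
  have [measurable]: "V \<in> measurable (borel \<Otimes>\<^sub>M borel) (borel \<Otimes>\<^sub>M borel)" unfolding V_def by measurable
  have "residual X \<tau> \<mu> = 0" using \<mu> by (simp add: residual_eq_0_iff)
  then have R: "residual X \<tau> (y u) = \<sigma> *\<^sub>R residual X \<tau> u" for u
    by (simp add: y_def linear_add[OF linear_residual] linear_cmul[OF linear_residual])
  have "hat_matrix X \<tau> *v \<mu> = \<mu>" using \<open>residual X \<tau> \<mu> = 0\<close> by (simp add: residual_eq)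
  then have H: "hat_matrix X \<tau> *v y u = \<mu> + \<sigma> *\<^sub>R (hat_matrix X \<tau> *v u)" for u
    by (simp add: y_def linear_add[OF linear_hat] linear_cmul[OF linear_hat])
  have W: "W_tilde X (y u) \<tau> = V (W_tilde X u \<tau>)" for u
    using \<sigma> by (simp add: W_tilde_def V_def H R)
  \<comment> \<open>The data are recovered from the pair and the direction. With zero residual the
    direction is \<open>0\<close> by convention, and the identity persists.\<close>
  have T: "T_tilde tb X (y u) \<tau> = t (V (W_tilde X u \<tau>)) (?e u)" for u
  proof -
    have "\<mu> + \<sigma> *\<^sub>R (hat_matrix X \<tau> *v u) + (\<sigma> * norm (residual X \<tau> u)) *\<^sub>R ?e u =
        \<mu> + \<sigma> *\<^sub>R (hat_matrix X \<tau> *v u + residual X \<tau> u)"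
      by (cases "residual X \<tau> u = 0") (simp_all add: scaleR_add_right)
    then have "y u = fst (V (W_tilde X u \<tau>)) + snd (V (W_tilde X u \<tau>)) *\<^sub>R ?e u"
      by (simp only: V_def W_tilde_def hat_plus_residual y_def fst_conv snd_conv)
    then show ?thesis unfolding t_def by (simp only:)
  qed
  define F where "F z = (indicator {z. t (V (fst z)) (snd z) \<in> B_set tb X \<alpha> \<tau> (V (fst z))} z :: ennreal)" for z
  have "Measurable.pred ((borel \<Otimes>\<^sub>M borel) \<Otimes>\<^sub>M borel)
      (\<lambda>z. t (V (fst z)) (snd z) \<in> B_set tb X \<alpha> \<tau> (V (fst z)))"
    unfolding t_def
    using measurable_compose[OF _ pred_T_tilde_in_B_set[of tb X \<tau> \<alpha>],
        of "\<lambda>z. (V (fst z), fst (V (fst z)) + snd (V (fst z)) *\<^sub>R snd z)"] by simp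
  then have [measurable]: "F \<in> borel_measurable ((borel \<Otimes>\<^sub>M borel) \<Otimes>\<^sub>M borel)"
    unfolding F_def by (auto simp: pred_def space_pair_measure intro!: borel_measurable_indicator)
  have cov: "ennreal \<alpha> \<le> (\<integral>\<^sup>+v. F (w, ?e v) \<partial>?N)" for w
  proof -
    let ?p = "cond_pmf tb X (V w) \<tau>"
    have m [measurable]: "{v. t (V w) (?e v) = s} \<in> sets borel" for s unfolding t_def by measurable
    have [measurable]: "(\<lambda>v. t (V w) (?e v)) \<in> measurable borel (count_space UNIV)" unfolding t_def by measurable
    have p: "?p s = measure ?N {v. t (V w) (?e v) = s}" for s by (simp add: cond_pmf_def t_def)
    have S: "measure ?N {v. t (V w) (?e v) \<in> S} = (\<Sum>s\<in>S. ?p s)" for S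
    proof -
      have "{v. t (V w) (?e v) \<in> S} = (\<Union>s\<in>S. {v. t (V w) (?e v) = s})" by auto
      then show ?thesis unfolding p
        by (simp only:) (rule N.finite_measure_finite_Union, auto simp: m disjoint_family_on_def)
    qed
    have "\<alpha> \<le> (\<Sum>s\<in>B_set tb X \<alpha> \<tau> (V w). ?p s)"
    proof -
      have "(\<Sum>s\<in>UNIV. ?p s) = 1" using S[of UNIV] N.prob_space by simp
      then show ?thesis
        unfolding B_set_def by (intro sum_highest_density_ge[of ?p]) (simp_all add: p \<alpha>)
    qed
    also have "\<dots> = measure ?N {v. t (V w) (?e v) \<in> B_set tb X \<alpha> \<tau> (V w)}" by (rule S[symmetric])
    finally have "ennreal \<alpha> \<le> emeasure ?N {v. t (V w) (?e v) \<in> B_set tb X \<alpha> \<tau> (V w)}"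
      by (simp add: N.emeasure_eq_measure)
    also have "\<dots> = (\<integral>\<^sup>+v. indicator {v. t (V w) (?e v) \<in> B_set tb X \<alpha> \<tau> (V w)} v \<partial>?N)"
      by (rule nn_integral_indicator[symmetric]) measurable
    also have "\<dots> = (\<integral>\<^sup>+v. F (w, ?e v) \<partial>?N)"
      by (intro nn_integral_cong) (simp add: F_def indicator_def)
    finally show ?thesis .
  qed
  have "ennreal \<alpha> = (\<integral>\<^sup>+u. ennreal \<alpha> \<partial>?N)" using N.emeasure_space_1 by simp
  also have "\<dots> \<le> (\<integral>\<^sup>+u. (\<integral>\<^sup>+v. F (W_tilde X u \<tau>, ?e v) \<partial>?N) \<partial>?N)"
    by (intro nn_integral_mono cov)
  also have "\<dots> = (\<integral>\<^sup>+u. F (W_tilde X u \<tau>, ?e u) \<partial>?N)"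
    by (rule nn_integral_W_direction_indep[OF _ \<tau>, symmetric]) measurable
  also have "\<dots> = (\<integral>\<^sup>+u. indicator {u. T_tilde tb X (y u) \<tau> \<in> B_set tb X \<alpha> \<tau> (W_tilde X (y u) \<tau>)} u \<partial>?N)"
    unfolding F_def indicator_def T W by simp
  also have "\<dots> = emeasure ?N {u. T_tilde tb X (y u) \<tau> \<in> B_set tb X \<alpha> \<tau> (W_tilde X (y u) \<tau>)}"
  proof (rule nn_integral_indicator)
    have "Measurable.pred borel (\<lambda>u. T_tilde tb X (y u) \<tau> \<in> B_set tb X \<alpha> \<tau> (W_tilde X (y u) \<tau>))"
      by (rule measurable_compose[OF _ pred_coverage]) (simp add: y_def)
    then show "{u. T_tilde tb X (y u) \<tau> \<in> B_set tb X \<alpha> \<tau> (W_tilde X (y u) \<tau>)} \<in> sets ?N"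
      by (simp only: pred_def sets_std_normal_vec space_borel UNIV_I simp_thms)
  qed
  finally show ?thesis .
qed

section \<open>Detection of the true model\<close>

text \<open>The penalty stays inside the infimum so that this is literally the objective of
  \<open>tau_hat\<close>.\<close>

definition criterion :: "real^'p^'n \<Rightarrow> real \<Rightarrow> real^'n \<Rightarrow> real^'n \<Rightarrow> 'p set \<Rightarrow> real" where
  "criterion X lam y u \<tau> =
     (INF (\<beta>, \<sigma>). (norm (y - submodel X \<tau> \<beta> - \<sigma> *\<^sub>R u))\<^sup>2 + lam * real (card \<tau>))"

text \<open>For \<open>R u \<noteq> 0\<close> this is the squared distance of \<open>y\<close> to the span of the columns in \<open>\<tau>\<close> and \<open>u\<close>.\<close>

definition profile_rss :: "real^'p^'n \<Rightarrow> 'p set \<Rightarrow> real^'n \<Rightarrow> real^'n \<Rightarrow> real" where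
  "profile_rss X \<tau> y u = (if residual X \<tau> u = 0 then 0 else
     (norm (residual X \<tau> y))\<^sup>2 - (residual X \<tau> y \<bullet> residual X \<tau> u)\<^sup>2 / (norm (residual X \<tau> u))\<^sup>2)"

lemma norm_residual_le: "norm (residual X \<tau> x) \<le> norm x"
  by (rule power2_le_imp_le) (simp_all add: norm_decomp[of x X \<tau>])

lemma norm_diff_scaleR_square:
  fixes a b :: "'a::real_inner"
  shows "(norm (a - s *\<^sub>R b))\<^sup>2 = (norm a)\<^sup>2 - 2 * s * (a \<bullet> b) + s\<^sup>2 * (norm b)\<^sup>2"
  unfolding power2_norm_eq_inner inner_diff_left inner_diff_right
  by (simp add: inner_commute[of b a] power2_eq_square algebra_simps)

lemma criterion_bdd_below:
  "bdd_below (range (\<lambda>(\<beta>, \<sigma>). (norm (y - submodel X \<tau> \<beta> - \<sigma> *\<^sub>R u))\<^sup>2 + lam * real (card \<tau>)))"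
  by (rule bdd_belowI[of _ "lam * real (card \<tau>)"]) auto

lemma criterion_le:
  "criterion X lam y u \<tau> \<le> (norm (y - submodel X \<tau> \<beta> - \<sigma> *\<^sub>R u))\<^sup>2 + lam * real (card \<tau>)"
  unfolding criterion_def using cINF_lower[OF criterion_bdd_below, of "(\<beta>, \<sigma>)"] by simp

lemma criterion_ge: "lam * real (card \<tau>) \<le> criterion X lam y u \<tau>"
  unfolding criterion_def by (rule cINF_greatest) auto

text \<open>Passing to residuals does not increase the norm and eliminates \<beta>; completing the
  square eliminates \<sigma>.\<close>

lemma criterion_ge_profile_rss:
  assumes "residual X \<tau> u \<noteq> 0"
  shows "profile_rss X \<tau> y u + lam * real (card \<tau>) \<le> criterion X lam y u \<tau>"
  unfolding criterion_def
proof (rule cINF_greatest)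
  fix z :: "(real^'b) \<times> real"
  obtain \<beta> \<sigma> where z: "z = (\<beta>, \<sigma>)" by (cases z)
  define a b where "a = residual X \<tau> y" and "b = residual X \<tau> u"
  have b: "norm b \<noteq> 0" using assms by (simp add: b_def)
  have "(norm (a - \<sigma> *\<^sub>R b))\<^sup>2 = (norm a)\<^sup>2 - 2 * \<sigma> * (a \<bullet> b) + \<sigma>\<^sup>2 * (norm b)\<^sup>2"
    by (rule norm_diff_scaleR_square)
  also have "\<dots> = (norm a)\<^sup>2 - (a \<bullet> b)\<^sup>2 / (norm b)\<^sup>2 + (\<sigma> * norm b - (a \<bullet> b) / norm b)\<^sup>2"
    unfolding power2_diff power_mult_distrib power_divide using b by simp
  finally have "profile_rss X \<tau> y u \<le> (norm (a - \<sigma> *\<^sub>R b))\<^sup>2"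
    using assms by (simp add: profile_rss_def a_def b_def)
  also have "a - \<sigma> *\<^sub>R b = residual X \<tau> (y - submodel X \<tau> \<beta> - \<sigma> *\<^sub>R u)"
    by (simp add: a_def b_def linear_diff[OF linear_residual] linear_cmul[OF linear_residual])
  also have "(norm \<dots>)\<^sup>2 \<le> (norm (y - submodel X \<tau> \<beta> - \<sigma> *\<^sub>R u))\<^sup>2"
    by (intro power_mono norm_residual_le) simp
  finally show "profile_rss X \<tau> y u + lam * real (card \<tau>) \<le>
      (case z of (\<beta>, \<sigma>) \<Rightarrow> (norm (y - submodel X \<tau> \<beta> - \<sigma> *\<^sub>R u))\<^sup>2 + lam * real (card \<tau>))"
    by (simp add: z)
qed (rule UNIV_not_empty)

lemma tau_hat_eqI:
  assumes "tie_breaking tb" and "\<And>\<tau>. \<tau> \<noteq> \<tau>\<^sub>0 \<Longrightarrow> criterion X lam y u \<tau>\<^sub>0 < criterion X lam y u \<tau>"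
  shows "tau_hat tb X lam y u = \<tau>\<^sub>0"
proof -
  have "is_arg_min (criterion X lam y u) (\<lambda>_. True) \<tau> \<longleftrightarrow> \<tau> = \<tau>\<^sub>0" for \<tau>
    using assms(2)[of \<tau>] unfolding is_arg_min_def by (metis assms(2) not_less_iff_gr_or_eq)
  then have "{\<tau>. is_arg_min (criterion X lam y u) (\<lambda>_. True) \<tau>} = {\<tau>\<^sub>0}" by simp
  then have "tau_hat tb X lam y u = tb {\<tau>\<^sub>0}"
    unfolding tau_hat_def criterion_def[symmetric] by simp
  then show ?thesis using assms(1) unfolding tie_breaking_def by (metis empty_not_insert singletonD)
qed

text \<open>At \<open>v = u\<close> the true coefficients fit exactly, so the true model pays its
  penalty only. Larger models lose by at least one further \<open>lam\<close>, the others by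
  \<open>profile_rss\<close>. These finitely many strict inequalities between bounds continuous at
  \<open>u\<close> persist nearby.\<close>

lemma eventually_tau_hat_eq:
  fixes X :: "real^'p^'n"
  assumes tb: "tie_breaking tb" and lam: "lam > 0"
    and good: "\<And>\<tau>. \<tau> \<noteq> \<tau>\<^sub>0 \<Longrightarrow> card \<tau> \<le> card \<tau>\<^sub>0 \<Longrightarrow> residual X \<tau> u \<noteq> 0 \<and>
        lam * (real (card \<tau>\<^sub>0) - real (card \<tau>)) < profile_rss X \<tau> (submodel X \<tau>\<^sub>0 \<beta>\<^sub>0 + \<sigma>\<^sub>0 *\<^sub>R u) u"
  shows "\<forall>\<^sub>F v in nhds u. tau_hat tb X lam (submodel X \<tau>\<^sub>0 \<beta>\<^sub>0 + \<sigma>\<^sub>0 *\<^sub>R u) v = \<tau>\<^sub>0"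
proof -
  define y where "y = submodel X \<tau>\<^sub>0 \<beta>\<^sub>0 + \<sigma>\<^sub>0 *\<^sub>R u"
  have id: "((\<lambda>v. v) \<longlongrightarrow> u) (nhds u)" by (rule filterlim_ident)
  have le: "criterion X lam y v \<tau>\<^sub>0 \<le> (norm (\<sigma>\<^sub>0 *\<^sub>R (u - v)))\<^sup>2 + lam * real (card \<tau>\<^sub>0)" for v
    using criterion_le[of X lam y v \<tau>\<^sub>0 \<beta>\<^sub>0 \<sigma>\<^sub>0] by (simp add: y_def scaleR_diff_right)
  have 0: "((\<lambda>v. (norm (\<sigma>\<^sub>0 *\<^sub>R (u - v)))\<^sup>2) \<longlongrightarrow> (norm (\<sigma>\<^sub>0 *\<^sub>R (u - u)))\<^sup>2) (nhds u)"
    by (intro tendsto_intros id)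
  have "\<forall>\<^sub>F v in nhds u. \<forall>\<tau>\<in>UNIV - {\<tau>\<^sub>0}. criterion X lam y v \<tau>\<^sub>0 < criterion X lam y v \<tau>"
  proof (rule eventually_ball_finite, simp, intro ballI)
    fix \<tau> assume "\<tau> \<in> UNIV - {\<tau>\<^sub>0}"
    then have \<tau>: "\<tau> \<noteq> \<tau>\<^sub>0" by simp
    show "\<forall>\<^sub>F v in nhds u. criterion X lam y v \<tau>\<^sub>0 < criterion X lam y v \<tau>"
    proof (cases "card \<tau> \<le> card \<tau>\<^sub>0")
      case False
      have "\<forall>\<^sub>F v in nhds u. (norm (\<sigma>\<^sub>0 *\<^sub>R (u - v)))\<^sup>2 < lam"
        using order_tendstoD(2)[OF 0, of lam] lam by simp
      then show ?thesis
      proof eventually_elim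
        case (elim v)
        have "real (card \<tau>\<^sub>0) + 1 \<le> real (card \<tau>)" using False by simp
        then have "lam * real (card \<tau>\<^sub>0) + lam \<le> lam * real (card \<tau>)"
          using lam by (metis distrib_left mult.right_neutral mult_le_cancel_left_pos)
        then show ?case using le[of v] elim criterion_ge[of lam \<tau> X y v] by linarith
      qed
    next
      case True
      let ?R = "residual X \<tau>"
      let ?f = "\<lambda>v. (norm (?R y))\<^sup>2 - (?R y \<bullet> ?R v)\<^sup>2 / (norm (?R v))\<^sup>2 - (norm (\<sigma>\<^sub>0 *\<^sub>R (u - v)))\<^sup>2"
      have nz: "?R u \<noteq> 0" using good[OF \<tau> True] by simp
      have lim: "(?R \<longlongrightarrow> ?R u) (nhds u)"
        using bounded_linear.tendsto[OF linear_residual[THEN linear_conv_bounded_linear[THEN iffD1]] id] .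
      have "(?f \<longlongrightarrow> ?f u) (nhds u)"
        by (intro tendsto_intros lim id) (use nz in simp)
      moreover have "lam * (real (card \<tau>\<^sub>0) - real (card \<tau>)) < ?f u"
        using good[OF \<tau> True] nz by (simp add: profile_rss_def y_def split: if_splits)
      ultimately have "\<forall>\<^sub>F v in nhds u. lam * (real (card \<tau>\<^sub>0) - real (card \<tau>)) < ?f v"
        by (rule order_tendstoD(1))
      moreover have "\<forall>\<^sub>F v in nhds u. ?R v \<noteq> 0"
        by (rule tendsto_imp_eventually_ne[OF lim nz])
      ultimately show ?thesis
      proof eventually_elim
        case (elim v)
        then show ?case
          using le[of v] criterion_ge_profile_rss[of X \<tau> v y lam]
          by (simp add: profile_rss_def algebra_simps)
      qed
    qed
  qed
  then show ?thesis unfolding y_def[symmetric]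
    by eventually_elim (rule tau_hat_eqI[OF tb], simp)
qed

section \<open>Measurability of the selected model\<close>

text \<open>The infimum may run over uncountably many functions: its strict sublevel sets are unions
  of open sets, hence open.\<close>

lemma measurable_INF_continuous:
  fixes f :: "'i \<Rightarrow> 'a::topological_space \<Rightarrow> real"
  assumes "\<And>i. continuous_on UNIV (f i)" and bdd: "\<And>x. bdd_below (range (\<lambda>i. f i x))"
  shows "(\<lambda>x. INF i. f i x) \<in> borel_measurable borel"
proof (rule borel_measurableI_less)
  fix a
  have "{x \<in> space borel. (INF i. f i x) < a} = (\<Union>i. {x. f i x < a})"
    using cINF_less_iff[OF UNIV_not_empty bdd] by auto
  moreover have "open {x. f i x < a}" for i
    by (intro open_Collect_less assms(1) continuous_on_const)
  ultimately show "{x \<in> space borel. (INF i. f i x) < a} \<in> sets borel"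
    by (simp add: borel_open open_UN)
qed

lemma measurable_criterion [measurable]:
  fixes X :: "real^'p^'n"
  shows "(\<lambda>z. criterion X lam (fst z) (snd z) \<tau>) \<in> borel_measurable (borel \<Otimes>\<^sub>M borel)"
proof -
  have "(\<lambda>z. INF i. (norm (fst z - submodel X \<tau> (fst i) - snd i *\<^sub>R snd z))\<^sup>2 + lam * real (card \<tau>))
      \<in> borel_measurable (borel :: ((real^'n) \<times> (real^'n)) measure)"
    using criterion_bdd_below[of _ X \<tau> _ lam]
    by (intro measurable_INF_continuous continuous_intros) (simp add: case_prod_beta)
  then show ?thesis by (simp add: criterion_def borel_prod case_prod_beta)
qed

lemma measurable_tau_hat [measurable]:
  fixes X :: "real^'p^'n"
  shows "(\<lambda>z. tau_hat tb X lam (fst z) (snd z)) \<in> measurable (borel \<Otimes>\<^sub>M borel) (count_space UNIV)"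
proof -
  have "(\<lambda>z. tb {\<tau>. is_arg_min (\<lambda>\<tau>. criterion X lam (fst z) (snd z) \<tau>) (\<lambda>_. True) \<tau>}) \<in>
      measurable (borel \<Otimes>\<^sub>M borel) (count_space UNIV)"
    by measurable
  then show ?thesis unfolding tau_hat_def criterion_def .
qed

section \<open>Separation of wrong models from the signal\<close>

text \<open>A vanishing value would put \<open>u\<close> into the span of \<mu> and the columns of
  the model. That span has dimension at most \<open>card \<tau> + 1\<close>, hence is a null
  set.\<close>

lemma AE_profile_rss_pos:
  fixes X :: "real^'p^'n"
  assumes \<mu>: "\<mu> \<notin> column_span X \<tau>" and \<tau>: "card \<tau> + 1 < CARD('n)"
  shows "AE u in std_normal_vec. 0 < profile_rss X \<tau> (\<mu> + \<sigma> *\<^sub>R u) u"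
proof -
  let ?C = "(\<lambda>j. column j X) ` \<tau>"
  have "dim (insert \<mu> ?C) \<le> card (insert \<mu> ?C)" by (rule dim_le_card') simp
  also have "\<dots> \<le> card \<tau> + 1" using card_image_le[of \<tau> "\<lambda>j. column j X"] by (simp add: card_insert_if)
  finally have "AE u in std_normal_vec. u \<notin> span (insert \<mu> ?C)"
    using \<tau> by (intro AE_not_in_proper_subspace) simp
  then show ?thesis
  proof eventually_elim
    case (elim u)
    define a b where "a = residual X \<tau> (\<mu> + \<sigma> *\<^sub>R u)" and "b = residual X \<tau> u"
    have span: "column_span X \<tau> \<subseteq> span (insert \<mu> ?C)"
      unfolding column_span_def by (intro span_mono) auto
    have b: "b \<noteq> 0" using elim span by (auto simp: b_def residual_eq_0_iff)
    \<comment> \<open>The coefficient of the projection of \<open>a\<close> onto \<open>b\<close>,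
      for which the squared distance is exactly the profile value.\<close>
    define s where "s = (a \<bullet> b) / (norm b)\<^sup>2"
    have "a \<noteq> s *\<^sub>R b"
    proof
      assume "a = s *\<^sub>R b"
      then have "residual X \<tau> (\<mu> - (s - \<sigma>) *\<^sub>R u) = 0"
        by (simp add: a_def b_def linear_add[OF linear_residual] linear_diff[OF linear_residual]
            linear_cmul[OF linear_residual] algebra_simps)
      then have mem: "\<mu> - (s - \<sigma>) *\<^sub>R u \<in> column_span X \<tau>" by (simp add: residual_eq_0_iff)
      show False
      \<comment> \<open>If the coefficient of \<open>u\<close> cancels, \<mu> itself lies in the
        column span; otherwise the relation can be solved for \<open>u\<close>.\<close>
      proof (cases "s = \<sigma>")
        case True
        then show False using mem \<mu> by simp
      next
        case False
        have "\<mu> - (\<mu> - (s - \<sigma>) *\<^sub>R u) \<in> span (insert \<mu> ?C)"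
          by (rule span_diff[OF span_base subsetD[OF span mem]]) simp
        from span_mul[OF this, of "1 / (s - \<sigma>)"] show False using False elim by simp
      qed
    qed
    then have "0 < (norm (a - s *\<^sub>R b))\<^sup>2" by simp
    also have "(norm (a - s *\<^sub>R b))\<^sup>2 = (norm a)\<^sup>2 - 2 * s * (a \<bullet> b) + s\<^sup>2 * (norm b)\<^sup>2"
      by (rule norm_diff_scaleR_square)
    also have "\<dots> = (norm a)\<^sup>2 - (a \<bullet> b)\<^sup>2 / (norm b)\<^sup>2"
      using b by (simp add: s_def power2_eq_square)
    finally show ?case using b by (simp add: profile_rss_def a_def b_def)
  qed
qed

text \<open>Continuity from below along the thresholds \<open>1 / real (Suc n)\<close>; strictness
  in \<open>c\<close> lets one threshold suffice. It supplies both the separation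
  \<open>\<kappa>\<close> and the detection probability \<open>q\<close>.\<close>

lemma (in finite_measure) positive_threshold:
  fixes f :: "'a \<Rightarrow> real"
  assumes [measurable]: "f \<in> borel_measurable M" and c: "c < measure M {x \<in> space M. 0 < f x}"
  shows "\<exists>\<epsilon>>0. c < measure M {x \<in> space M. \<epsilon> < f x}"
proof -
  let ?A = "\<lambda>n. {x \<in> space M. 1 / real (Suc n) < f x}"
  have "incseq ?A"
  proof (intro monoI subsetI)
    fix m n :: nat and x assume "m \<le> n" and x: "x \<in> ?A m"
    then have "1 / real (Suc n) \<le> 1 / real (Suc m)" by (intro frac_le) auto
    then show "x \<in> ?A n" using x by simp
  qed
  then have "(\<lambda>n. measure M (?A n)) \<longlonglongrightarrow> measure M (\<Union>n. ?A n)"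
    by (intro finite_Lim_measure_incseq) auto
  moreover have "(\<Union>n. ?A n) = {x \<in> space M. 0 < f x}"
  proof (intro set_eqI iffI)
    fix x assume x: "x \<in> {x \<in> space M. 0 < f x}"
    then obtain n where "inverse (real (Suc n)) < f x" using reals_Archimedean by blast
    then show "x \<in> (\<Union>n. ?A n)" using x by (auto simp: inverse_eq_divide)
  next
    fix x assume "x \<in> (\<Union>n. ?A n)"
    then obtain n where "x \<in> space M" "1 / real (Suc n) < f x" by blast
    moreover have "0 < 1 / real (Suc n)" by simp
    ultimately have "0 < f x" by linarith
    then show "x \<in> {x \<in> space M. 0 < f x}" using \<open>x \<in> space M\<close> by simp
  qed
  ultimately have "\<forall>\<^sub>F n in sequentially. c < measure M (?A n)"
    using c by (intro order_tendstoD(1)) auto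
  then obtain n where "c < measure M (?A n)" by (auto simp: eventually_sequentially)
  then show ?thesis by (intro exI[of _ "1 / real (Suc n)"]) simp
qed

text \<open>A model that reproduces the signal with no more columns than
  \<open>\<tau>\<^sub>0\<close> would itself have smallest cardinality, against uniqueness.\<close>

lemma identifiable_not_in_column_span:
  assumes "identifiable X \<tau>\<^sub>0 \<beta>\<^sub>0" and "\<tau> \<noteq> \<tau>\<^sub>0" and "card \<tau> \<le> card \<tau>\<^sub>0"
  shows "submodel X \<tau>\<^sub>0 \<beta>\<^sub>0 \<notin> column_span X \<tau>"
proof
  let ?P = "\<lambda>\<tau>. \<exists>\<beta>. submodel X \<tau> \<beta> = submodel X \<tau>\<^sub>0 \<beta>\<^sub>0"
  assume "submodel X \<tau>\<^sub>0 \<beta>\<^sub>0 \<in> column_span X \<tau>"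
  then have "?P \<tau>" unfolding range_submodel[symmetric] by (auto simp: image_iff)
  moreover have *: "is_arg_min card ?P \<tau>' \<longleftrightarrow> \<tau>' = \<tau>\<^sub>0" for \<tau>'
    using assms(1) unfolding identifiable_def by blast
  ultimately have "is_arg_min card ?P \<tau>"
    using *[of \<tau>\<^sub>0] assms(3) unfolding is_arg_min_def by (meson le_less_trans not_less order_trans)
  then show False using * assms(2) by simp
qed

lemma C_min_pos:
  fixes X :: "real^'p^'n"
  assumes "identifiable X \<tau>\<^sub>0 \<beta>\<^sub>0" and "\<tau>\<^sub>0 \<noteq> {}"
  shows "0 < C_min X \<tau>\<^sub>0 \<beta>\<^sub>0"
proof -
  let ?S = "{\<tau>. \<tau> \<noteq> \<tau>\<^sub>0 \<and> card \<tau> \<le> card \<tau>\<^sub>0}"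
  \<comment> \<open>The minimum needs at least one competitor; the empty model is one because
    \<open>\<tau>\<^sub>0\<close> is nonempty.\<close>
  have "{} \<in> ?S" using assms(2) by simp
  then have "?S \<noteq> {}" by blast
  moreover have "0 < (INF \<beta>. (norm (submodel X \<tau>\<^sub>0 \<beta>\<^sub>0 - submodel X \<tau> \<beta>))\<^sup>2
      / (real CARD('n) * real (max (card (\<tau>\<^sub>0 - \<tau>)) 1)))" if "\<tau> \<in> ?S" for \<tau>
  proof -
    let ?\<mu> = "submodel X \<tau>\<^sub>0 \<beta>\<^sub>0" and ?c = "real CARD('n) * real (max (card (\<tau>\<^sub>0 - \<tau>)) 1)"
    have c: "0 < ?c" by (intro mult_pos_pos) auto
    have "residual X \<tau> ?\<mu> \<noteq> 0"
      using identifiable_not_in_column_span[OF assms(1)] that by (simp add: residual_eq_0_iff)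
    then have "0 < rss X \<tau> ?\<mu> / ?c" using c by (simp add: rss_eq)
    also have "\<dots> \<le> (INF \<beta>. (norm (?\<mu> - submodel X \<tau> \<beta>))\<^sup>2 / ?c)"
    proof (rule cINF_greatest)
      fix \<beta>
      have "rss X \<tau> ?\<mu> \<le> (norm (?\<mu> - submodel X \<tau> \<beta>))\<^sup>2"
        unfolding rss_def by (rule cINF_lower) (auto intro: bdd_belowI[of _ 0])
      then show "rss X \<tau> ?\<mu> / ?c \<le> (norm (?\<mu> - submodel X \<tau> \<beta>))\<^sup>2 / ?c"
        using c by (intro divide_right_mono) auto
    qed simp
    finally show ?thesis .
  qed
  ultimately show ?thesis unfolding C_min_def by (subst Min_gr_iff) auto
qed

text \<open>The minimum of finitely many almost surely positive functions is almost surely positive.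
  The bound \<open>\<kappa>\<close> does not involve the penalty, so \<gamma> can be chosen after
  it.\<close>

lemma profile_rss_threshold:
  fixes X :: "real^'p^'n"
  assumes "\<tau>\<^sub>0 \<noteq> {}" and id: "identifiable X \<tau>\<^sub>0 \<beta>\<^sub>0" and n: "card \<tau>\<^sub>0 + 1 < CARD('n)" and "\<delta> > 0"
  shows "\<exists>\<kappa>>0. 1 - \<delta> < measure std_normal_vec {u. \<forall>\<tau>. \<tau> \<noteq> \<tau>\<^sub>0 \<longrightarrow> card \<tau> \<le> card \<tau>\<^sub>0 \<longrightarrow>
     \<kappa> < profile_rss X \<tau> (submodel X \<tau>\<^sub>0 \<beta>\<^sub>0 + \<sigma> *\<^sub>R u) u}"
proof -
  let ?N = "std_normal_vec :: (real^'n) measure"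
  interpret N: prob_space ?N by (rule prob_space_std_normal_vec)
  let ?S = "{\<tau>. \<tau> \<noteq> \<tau>\<^sub>0 \<and> card \<tau> \<le> card \<tau>\<^sub>0}"
  let ?y = "\<lambda>u. submodel X \<tau>\<^sub>0 \<beta>\<^sub>0 + \<sigma> *\<^sub>R u"
  define f where "f u = Min ((\<lambda>\<tau>. profile_rss X \<tau> (?y u) u) ` ?S)" for u
  have [measurable]: "(\<lambda>u. profile_rss X \<tau> (?y u) u) \<in> borel_measurable borel" for \<tau>
    unfolding profile_rss_def by measurable
  have [measurable]: "f \<in> borel_measurable ?N" unfolding f_def by measurable
  have "{} \<in> ?S" using assms(1) by simp
  then have ne: "?S \<noteq> {}" by blast
  have gr: "\<kappa> < f u \<longleftrightarrow> (\<forall>\<tau>\<in>?S. \<kappa> < profile_rss X \<tau> (?y u) u)" for \<kappa> u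
    unfolding f_def using ne by (subst Min_gr_iff) auto
  have "AE u in ?N. \<forall>\<tau>\<in>?S. 0 < profile_rss X \<tau> (?y u) u"
  proof (subst AE_finite_all, simp, intro ballI)
    fix \<tau> assume "\<tau> \<in> ?S"
    then show "AE u in ?N. 0 < profile_rss X \<tau> (?y u) u"
      using n identifiable_not_in_column_span[OF id] by (intro AE_profile_rss_pos) auto
  qed
  then have "measure ?N {u \<in> space ?N. 0 < f u} = 1"
    by (intro N.prob_eq_1[THEN iffD2]) (simp_all add: gr)
  then obtain \<kappa> where "\<kappa> > 0" "1 - \<delta> < measure ?N {u \<in> space ?N. \<kappa> < f u}"
    using N.positive_threshold[of f "1 - \<delta>"] \<open>\<delta> > 0\<close> by auto
  then show ?thesis by (intro exI[of _ \<kappa>]) (simp add: gr imp_conjL)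
qed

section \<open>Detection probability of a single draw\<close>

lemma pred_detection:
  fixes X :: "real^'p^'n"
  shows "Measurable.pred (borel \<Otimes>\<^sub>M borel) (\<lambda>z. tau_hat tb X lam (\<mu> + \<sigma> *\<^sub>R fst z) (snd z) = \<tau>)"
proof -
  have "(\<lambda>z. tau_hat tb X lam (\<mu> + \<sigma> *\<^sub>R fst z) (snd z)) \<in> measurable (borel \<Otimes>\<^sub>M borel) (count_space UNIV)"
    using measurable_compose[OF _ measurable_tau_hat[of tb X lam],
        of "\<lambda>z. (\<mu> + \<sigma> *\<^sub>R fst z, snd z)" "borel \<Otimes>\<^sub>M borel"] by simp
  then show ?thesis by measurable
qed

lemma measurable_detection_probability:
  fixes X :: "real^'p^'n"
  shows "(\<lambda>u. measure std_normal_vec {v. tau_hat tb X lam (\<mu> + \<sigma> *\<^sub>R u) v = \<tau>}) \<in> borel_measurable borel"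
proof -
  let ?N = "std_normal_vec :: (real^'n) measure"
  interpret N: prob_space ?N by (rule prob_space_std_normal_vec)
  define Q where "Q = {z \<in> space (borel \<Otimes>\<^sub>M ?N). tau_hat tb X lam (\<mu> + \<sigma> *\<^sub>R fst z) (snd z) = \<tau>}"
  note [measurable] = pred_detection
  have "Q \<in> sets (borel \<Otimes>\<^sub>M ?N)" unfolding Q_def by measurable
  from N.measurable_emeasure_Pair[OF this]
  have "(\<lambda>u. enn2real (emeasure ?N (Pair u -` Q))) \<in> borel_measurable borel" by measurable
  moreover have "Pair u -` Q = {v. tau_hat tb X lam (\<mu> + \<sigma> *\<^sub>R u) v = \<tau>}" for u
    by (auto simp: Q_def space_pair_measure)
  ultimately show ?thesis by (simp add: measure_def)
qed

text \<open>Each separated \<open>u\<close> has a neighbourhood of detecting draws, hence a positive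
  detection probability. A uniform \<open>q\<close> follows by giving up part of the slack in the
  strict bound.\<close>

lemma detection_probability_threshold:
  fixes X :: "real^'p^'n"
  assumes tb: "tie_breaking tb" and lam: "lam > 0" "lam * real (card \<tau>\<^sub>0) \<le> \<kappa>"
    and \<kappa>: "c < measure std_normal_vec {u. \<forall>\<tau>. \<tau> \<noteq> \<tau>\<^sub>0 \<longrightarrow> card \<tau> \<le> card \<tau>\<^sub>0 \<longrightarrow>
     \<kappa> < profile_rss X \<tau> (submodel X \<tau>\<^sub>0 \<beta>\<^sub>0 + \<sigma> *\<^sub>R u) u}"
  shows "\<exists>q>0. c < measure std_normal_vec {u. q < measure std_normal_vec
      {v. tau_hat tb X lam (submodel X \<tau>\<^sub>0 \<beta>\<^sub>0 + \<sigma> *\<^sub>R u) v = \<tau>\<^sub>0}}"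
proof -
  let ?N = "std_normal_vec :: (real^'n) measure"
  interpret N: prob_space ?N by (rule prob_space_std_normal_vec)
  let ?y = "\<lambda>u. submodel X \<tau>\<^sub>0 \<beta>\<^sub>0 + \<sigma> *\<^sub>R u"
  define h where "h u = measure ?N {v. tau_hat tb X lam (?y u) v = \<tau>\<^sub>0}" for u
  have [measurable]: "h \<in> borel_measurable ?N"
    unfolding h_def[abs_def] measurable_cong_sets[OF sets_std_normal_vec refl]
    by (rule measurable_detection_probability)
  have "{u. \<forall>\<tau>. \<tau> \<noteq> \<tau>\<^sub>0 \<longrightarrow> card \<tau> \<le> card \<tau>\<^sub>0 \<longrightarrow> \<kappa> < profile_rss X \<tau> (?y u) u} \<subseteq> {u \<in> space ?N. 0 < h u}"
  proof
    fix u assume u: "u \<in> {u. \<forall>\<tau>. \<tau> \<noteq> \<tau>\<^sub>0 \<longrightarrow> card \<tau> \<le> card \<tau>\<^sub>0 \<longrightarrow> \<kappa> < profile_rss X \<tau> (?y u) u}"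
    have "0 \<le> \<kappa>" using lam by (meson less_imp_le mult_nonneg_nonneg of_nat_0_le_iff order_trans)
    have "\<forall>\<^sub>F v in nhds u. tau_hat tb X lam (?y u) v = \<tau>\<^sub>0"
    proof (rule eventually_tau_hat_eq[OF tb lam(1)])
      fix \<tau> assume \<tau>: "\<tau> \<noteq> \<tau>\<^sub>0" "card \<tau> \<le> card \<tau>\<^sub>0"
      have "lam * (real (card \<tau>\<^sub>0) - real (card \<tau>)) \<le> lam * real (card \<tau>\<^sub>0)"
        using lam(1) by (intro mult_left_mono) auto
      moreover have less: "\<kappa> < profile_rss X \<tau> (?y u) u" using u \<tau> by blast
      \<comment> \<open>The default value \<open>0\<close> of \<open>profile_rss\<close> excludes
        the degenerate case as soon as the value is positive.\<close>
      moreover have "residual X \<tau> u \<noteq> 0" using less \<open>0 \<le> \<kappa>\<close> by (auto simp: profile_rss_def)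
      ultimately show "residual X \<tau> u \<noteq> 0 \<and>
          lam * (real (card \<tau>\<^sub>0) - real (card \<tau>)) < profile_rss X \<tau> (?y u) u"
        using lam(2) by linarith
    qed
    then obtain W where W: "open W" "u \<in> W" "\<And>v. v \<in> W \<Longrightarrow> tau_hat tb X lam (?y u) v = \<tau>\<^sub>0"
      unfolding eventually_nhds by blast
    have [measurable]: "(\<lambda>v. tau_hat tb X lam (?y u) v) \<in> measurable borel (count_space UNIV)"
      using measurable_compose[OF measurable_Pair1' measurable_tau_hat[of tb X lam], of "?y u"] by simp
    have "0 < emeasure ?N W" using W by (intro open_std_normal_vec_pos) auto
    also have "\<dots> \<le> emeasure ?N {v. tau_hat tb X lam (?y u) v = \<tau>\<^sub>0}"
      using W(3) by (intro emeasure_mono) auto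
    finally show "u \<in> {u \<in> space ?N. 0 < h u}"
      by (simp add: h_def N.emeasure_eq_measure)
  qed
  then have "measure ?N {u. \<forall>\<tau>. \<tau> \<noteq> \<tau>\<^sub>0 \<longrightarrow> card \<tau> \<le> card \<tau>\<^sub>0 \<longrightarrow> \<kappa> < profile_rss X \<tau> (?y u) u}
      \<le> measure ?N {u \<in> space ?N. 0 < h u}"
    by (intro N.finite_measure_mono) auto
  then obtain q where "q > 0" "c < measure ?N {u \<in> space ?N. q < h u}"
    using N.positive_threshold[of h c] \<kappa> by auto
  then show ?thesis unfolding h_def by auto
qed

section \<open>Repeated independent draws\<close>

text \<open>For a fixed value \<open>u\<close> of \<open>U\<close> in \<open>G\<close> the draws
  fail independently, each with probability at most \<open>1 - q\<close>. Placing \<open>U\<close>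
  at index \<open>None\<close> and the draws at \<open>Some b\<close> turns this conditioning into
  Fubini on a product measure.\<close>

lemma (in prob_space) prob_no_success_le:
  fixes U :: "'a \<Rightarrow> 'b::topological_space" and Us :: "nat \<Rightarrow> 'a \<Rightarrow> 'b"
  assumes ind: "indep_vars (\<lambda>_. borel) (case_option U Us) UNIV"
    and U: "distr M borel U = N" and Us: "\<And>b. distr M borel (Us b) = N"
    and G [measurable]: "G \<in> sets borel"
    and P [measurable]: "Measurable.pred (borel \<Otimes>\<^sub>M borel) (\<lambda>z. P (fst z) (snd z))"
    and q: "\<And>u. u \<in> G \<Longrightarrow> q \<le> measure N {v. P u v}" and "q \<le> 1"
  shows "prob {\<omega> \<in> space M. U \<omega> \<in> G \<and> (\<forall>b<d. \<not> P (U \<omega>) (Us b \<omega>))} \<le> (1 - q) ^ d"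
proof -
  define I where "I = Some ` {..<d}"
  define X where "X = case_option U Us"
  have rvX: "random_variable borel (X i)" for i
    using ind by (auto simp: indep_vars_def X_def)
  have rv [measurable]: "random_variable borel U" "random_variable borel (Us b)" for b
    using rvX[of None] rvX[of "Some b"] by (auto simp: X_def)
  have dX: "distr M borel (X i) = N" for i using U Us by (cases i) (auto simp: X_def)
  have setsN [measurable_cong]: "sets N = sets borel" using U by auto
  have spN: "space N = UNIV" using U by auto
  interpret N: prob_space N using prob_space_distr[OF rv(1)] U by simp
  interpret P: product_sigma_finite "\<lambda>_::nat option. N" by standard
  interpret PP: product_prob_space "\<lambda>_::nat option. N" by standard
  have "indep_vars (\<lambda>_. borel) X (insert None I)"
    using ind unfolding X_def by (rule indep_vars_subset) auto
  then have eq: "distr M (\<Pi>\<^sub>M i\<in>insert None I. borel) (\<lambda>x. \<lambda>i\<in>insert None I. X i x) = (\<Pi>\<^sub>M i\<in>insert None I. N)"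
    using rvX by (subst (asm) indep_vars_iff_distr_eq_PiM') (auto simp: dX)
  define S where "S = {x \<in> space (\<Pi>\<^sub>M i\<in>insert None I. (borel :: 'b measure)).
      x None \<in> G \<and> (\<forall>i\<in>I. \<not> P (x None) (x i))}"
  have [measurable]: "finite I" by (simp add: I_def)
  have S: "S \<in> sets (\<Pi>\<^sub>M i\<in>insert None I. borel)"
  proof -
    have "Measurable.pred (\<Pi>\<^sub>M i\<in>insert None I. borel) (\<lambda>x. P (x None) (x i))" if "i \<in> I" for i
      using measurable_compose[OF _ P, of "\<lambda>x. (x None, x i)"] that by simp
    then show ?thesis unfolding S_def by measurable
  qed
  have setsP: "sets (\<Pi>\<^sub>M i\<in>J. N) = sets (\<Pi>\<^sub>M i\<in>J. borel)" for J :: "nat option set"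
    by (intro sets_PiM_cong) (auto simp: setsN)
  have PS: "{v. \<not> P u v} \<in> sets borel" for u
  proof -
    have "Measurable.pred borel (\<lambda>v. P u v)"
      using measurable_compose[OF measurable_Pair1' P, of u] by simp
    then have "Measurable.pred borel (\<lambda>v. \<not> P u v)" by measurable
    then show ?thesis by (simp add: pred_def)
  qed
  have inner: "emeasure (\<Pi>\<^sub>M i\<in>I. N) (\<Pi>\<^sub>E i\<in>I. {v. \<not> P u v}) \<le> ennreal ((1 - q) ^ d)" if u: "u \<in> G" for u
  proof -
    have "emeasure (\<Pi>\<^sub>M i\<in>I. N) (\<Pi>\<^sub>E i\<in>I. {v. \<not> P u v}) = (\<Prod>i\<in>I. emeasure N {v. \<not> P u v})"
      using PS by (intro P.emeasure_PiM) (auto simp: I_def setsN)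
    also have "\<dots> = ennreal (measure N {v. \<not> P u v} ^ d)"
      by (simp add: I_def card_image N.emeasure_eq_measure ennreal_power)
    also have "measure N {v. \<not> P u v} = 1 - measure N {v. P u v}"
    proof -
      have "{v. P u v} = - {v. \<not> P u v}" by auto
      then have "{v. P u v} \<in> sets N" using PS[of u] by (simp add: setsN borel_comp)
      from N.prob_compl[OF this] show ?thesis by (simp add: spN set_diff_eq)
    qed
    also have "ennreal ((1 - measure N {v. P u v}) ^ d) \<le> ennreal ((1 - q) ^ d)"
      using q[OF u] by (intro ennreal_leI power_mono) auto
    finally show ?thesis .
  qed
  have "emeasure M {\<omega> \<in> space M. U \<omega> \<in> G \<and> (\<forall>b<d. \<not> P (U \<omega>) (Us b \<omega>))} =
      emeasure (distr M (\<Pi>\<^sub>M i\<in>insert None I. borel) (\<lambda>x. \<lambda>i\<in>insert None I. X i x)) S"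
    using S rvX
    by (subst emeasure_distr) (auto intro!: arg_cong[where f="emeasure M"] measurable_restrict
      simp: S_def I_def X_def space_PiM)
  also have "\<dots> = emeasure (\<Pi>\<^sub>M i\<in>insert None I. N) S" unfolding eq ..
  also have "\<dots> = (\<integral>\<^sup>+x. indicator S x \<partial>(\<Pi>\<^sub>M i\<in>insert None I. N))"
    using S by (intro nn_integral_indicator[symmetric]) (simp add: setsP)
  \<comment> \<open>The coordinate \<open>None\<close> is integrated outermost, so the inner
    integral sees only the draws.\<close>
  also have "\<dots> = (\<integral>\<^sup>+u. (\<integral>\<^sup>+x. indicator S (x(None := u)) \<partial>(\<Pi>\<^sub>M i\<in>I. N)) \<partial>N)"
  proof (rule P.product_nn_integral_insert_rev)
    show "(\<lambda>x. indicator S x :: ennreal) \<in> borel_measurable (\<Pi>\<^sub>M i\<in>insert None I. N)"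
      using S by (intro borel_measurable_indicator) (simp add: setsP)
  qed (auto simp: I_def)
  also have "\<dots> \<le> (\<integral>\<^sup>+u. ennreal ((1 - q) ^ d) \<partial>N)"
  proof (rule nn_integral_mono)
    fix u
    show "(\<integral>\<^sup>+x. indicator S (x(None := u)) \<partial>(\<Pi>\<^sub>M i\<in>I. N)) \<le> ennreal ((1 - q) ^ d)"
    proof (cases "u \<in> G")
      case False
      then have "(\<integral>\<^sup>+x. indicator S (x(None := u)) \<partial>(\<Pi>\<^sub>M i\<in>I. N)) = 0"
        by (simp add: S_def)
      then show ?thesis by simp
    next
      case True
      have "(\<integral>\<^sup>+x. indicator S (x(None := u)) \<partial>(\<Pi>\<^sub>M i\<in>I. N)) \<le>
          (\<integral>\<^sup>+x. indicator (\<Pi>\<^sub>E i\<in>I. {v. \<not> P u v}) x \<partial>(\<Pi>\<^sub>M i\<in>I. N))"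
        by (intro nn_integral_mono) (auto simp: S_def I_def indicator_def space_PiM PiE_iff)
      also have "\<dots> = emeasure (\<Pi>\<^sub>M i\<in>I. N) (\<Pi>\<^sub>E i\<in>I. {v. \<not> P u v})"
        using PS by (intro nn_integral_indicator sets_PiM_I_finite) (auto simp: I_def setsN)
      finally show ?thesis using inner[OF True] by (rule order_trans)
    qed
  qed
  also have "\<dots> = ennreal ((1 - q) ^ d)" using N.emeasure_space_1 by simp
  finally show ?thesis
    using \<open>q \<le> 1\<close> by (simp add: emeasure_eq_measure)
qed

section \<open>Independence and exponential bounds\<close>

lemma (in prob_space) real_cond_exp_indep:
  assumes F: "subalgebra M F" and A [measurable]: "A \<in> events"
    and indep: "\<And>S. S \<in> sets F \<Longrightarrow> prob (A \<inter> S) = prob A * prob S"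
  shows "AE \<omega> in M. real_cond_exp M F (indicator A) \<omega> = prob A"
proof -
  interpret finite_measure_subalgebra M F by unfold_locales (rule F)
  show ?thesis
  proof (rule real_cond_exp_charact)
    fix S assume S: "S \<in> sets F"
    then have [measurable]: "S \<in> events" using F by (auto simp: subalgebra_def)
    have "(\<integral>x\<in>S. indicator A x \<partial>M) = (\<integral>x. indicator (A \<inter> S) x \<partial>M)"
      unfolding set_lebesgue_integral_def by (intro Bochner_Integration.integral_cong) (auto simp: indicator_def)
    also have "\<dots> = prob A * prob S" by (simp add: indep[OF S] Int_absorb2 sets.sets_into_space)
    also have "\<dots> = (\<integral>x\<in>S. prob A \<partial>M)"
      by (simp add: set_lebesgue_integral_def Int_absorb2 sets.sets_into_space)
    finally show "(\<integral>x\<in>S. indicator A x \<partial>M) = (\<integral>x\<in>S. prob A \<partial>M)" .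
  qed (auto intro: integrable_real_indicator simp: emeasure_eq_measure)
qed

lemma subalgebra_sigma_Ud:
  assumes "\<And>b. Us b \<in> borel_measurable M"
  shows "subalgebra M (sigma_Ud M Us d)"
proof -
  have "(\<lambda>\<omega>. \<lambda>b\<in>{..<d}. Us b \<omega>) \<in> measurable M (\<Pi>\<^sub>M b\<in>{..<d}. borel)"
    using assms by (intro measurable_restrict) auto
  moreover have "(\<lambda>\<omega>. \<lambda>b\<in>{..<d}. Us b \<omega>) \<in> space M \<rightarrow> space (\<Pi>\<^sub>M b\<in>{..<d}. borel)"
    by (auto simp: space_PiM)
  ultimately show ?thesis
    unfolding subalgebra_def sigma_Ud_def by (auto simp: sets_vimage_algebra2 intro: measurable_sets)
qed

text \<open>The index blocks of \<open>U\<close> and of the first \<open>d\<close> draws are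
  disjoint, so the corresponding restrictions are independent; \<open>S\<close> is a preimage under
  the second block after relabelling.\<close>

lemma (in prob_space) prob_indep_sigma_Ud:
  fixes U :: "'a \<Rightarrow> real^'n" and Us :: "nat \<Rightarrow> 'a \<Rightarrow> real^'n"
  assumes ind: "indep_vars (\<lambda>_. borel) (case_option U Us) UNIV"
    and K: "K \<in> sets borel" and S: "S \<in> sets (sigma_Ud M Us d)"
  shows "prob ((U -` K \<inter> space M) \<inter> S) = prob (U -` K \<inter> space M) * prob S"
proof -
  let ?Z = "\<lambda>\<omega>. \<lambda>b\<in>{..<d}. Us b \<omega>"
  define Q where "Q = Some ` {..<d}"
  let ?V = "\<lambda>J \<omega>. restrict (\<lambda>i. case_option U Us i \<omega>) J"
  let ?Y = "\<lambda>x :: nat option \<Rightarrow> real^'n. \<lambda>b\<in>{..<d}. x (Some b)"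
  have iv: "indep_var (PiM {None} (\<lambda>_. borel)) (?V {None}) (PiM Q (\<lambda>_. borel)) (?V Q)"
    using ind by (rule indep_var_restrict) (auto simp: Q_def)
  obtain B where B: "B \<in> sets (\<Pi>\<^sub>M b\<in>{..<d}. (borel :: (real^'n) measure))" "S = ?Z -` B \<inter> space M"
    using S unfolding sigma_Ud_def by (subst (asm) sets_vimage_algebra2) (auto simp: space_PiM)
  have "(\<lambda>x. x None) \<in> measurable (PiM {None} (\<lambda>_::nat option. borel)) (borel :: (real^'n) measure)"
    by measurable
  from measurable_sets[OF this K] have Ka:
    "(\<lambda>x. x None) -` K \<inter> space (PiM {None} (\<lambda>_. borel)) \<in> sets (PiM {None} (\<lambda>_::nat option. borel))" .
  have "?Y \<in> measurable (PiM Q (\<lambda>_. borel)) (\<Pi>\<^sub>M b\<in>{..<d}. borel)"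
    by (intro measurable_restrict measurable_component_singleton) (auto simp: Q_def)
  from measurable_sets[OF this B(1)] have Ba: "?Y -` B \<inter> space (PiM Q (\<lambda>_. borel)) \<in> sets (PiM Q (\<lambda>_. borel))" .
  have Y: "?Y (?V Q \<omega>) = ?Z \<omega>" for \<omega>
    by (auto simp: fun_eq_iff restrict_def Q_def)
  have 1: "?V {None} -` ((\<lambda>x. x None) -` K \<inter> space (PiM {None} (\<lambda>_. borel))) \<inter> space M = U -` K \<inter> space M"
    by (auto simp: space_PiM)
  have 2: "?V Q -` (?Y -` B \<inter> space (PiM Q (\<lambda>_. borel))) \<inter> space M = S"
    unfolding B(2) vimage_Int by (auto simp: space_PiM Y simp del: restrict_apply)
  have 3: "(\<lambda>\<omega>. (?V {None} \<omega>, ?V Q \<omega>)) -` (((\<lambda>x. x None) -` K \<inter> space (PiM {None} (\<lambda>_. borel))) \<times>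
      (?Y -` B \<inter> space (PiM Q (\<lambda>_. borel)))) \<inter> space M = (U -` K \<inter> space M) \<inter> S"
    unfolding 1[symmetric] 2[symmetric] by blast
  show ?thesis using indep_varD[OF iv Ka Ba] unfolding 1 2 3 .
qed

text \<open>When \<open>U\<close> lies in \<open>K\<close>, the event \<open>E d\<close> can fail
  only on \<open>bad d\<close>. The probability of \<open>bad d\<close> is the remainder in the
  joint bound, up to an explicit majorant, and its conditional probability is the remainder in the
  conditional bound.\<close>

lemma (in prob_space) exponential_lower_bounds:
  fixes U :: "'a \<Rightarrow> real^'n" and Us :: "nat \<Rightarrow> 'a \<Rightarrow> real^'n"
  assumes ind: "indep_vars (\<lambda>_. borel) (case_option U Us) UNIV"
    and U: "distr M borel U = N" and Us: "\<And>b. distr M borel (Us b) = N"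
    and K [measurable]: "K \<in> sets borel" and c: "c \<le> measure N K"
    and P [measurable]: "Measurable.pred (borel \<Otimes>\<^sub>M borel) (\<lambda>z. P (fst z) (snd z))"
    and q: "0 < q" "\<And>u. u \<in> K \<Longrightarrow> q \<le> measure N {v. P u v}"
    and E [measurable]: "\<And>d. E d \<in> events"
    and sub: "\<And>d. {\<omega> \<in> space M. U \<omega> \<in> K \<and> (\<exists>b<d. P (U \<omega>) (Us b \<omega>))} \<subseteq> E d"
  shows "\<exists>c\<^sub>1>0. (\<exists>r. r \<in> o(\<lambda>d. exp (- c\<^sub>1 * real d)) \<and> (\<forall>d. c - r d \<le> prob (E d))) \<and>
    (\<exists>R. (\<forall>d. R d \<in> borel_measurable (sigma_Ud M Us d)) \<and>
       little_o_p M R (\<lambda>d. exp (- c\<^sub>1 * real d)) \<and>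
       (\<forall>d. AE \<omega> in M. c - R d \<omega> \<le> real_cond_exp M (sigma_Ud M Us d) (indicator (E d)) \<omega>))"
proof -
  \<comment> \<open>The square root splits the failure bound into \<open>s ^ d * s ^ d\<close>: one
    factor is the rate, the other tends to \<open>0\<close> and gives the little-o. Capping
    \<open>q\<close> at \<open>1 / 2\<close> keeps \<open>s\<close> positive, so that its logarithm
    defines the rate.\<close>
  define s where "s = sqrt (1 - min q (1 / 2))"
  have s: "0 < s" "s < 1" and s2: "s * s = 1 - min q (1 / 2)"
    using q(1) by (auto simp: s_def)
  have rvX: "random_variable borel (case_option U Us i)" for i
    using ind by (auto simp: indep_vars_def)
  have [measurable]: "random_variable borel U" "random_variable borel (Us b)" for b
    using rvX[of None] rvX[of "Some b"] by auto
  define bad where "bad d = {\<omega> \<in> space M. U \<omega> \<in> K \<and> (\<forall>b<d. \<not> P (U \<omega>) (Us b \<omega>))}" for d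
  define A where "A = U -` K \<inter> space M"
  have [measurable]: "A \<in> events" unfolding A_def by measurable
  have "Measurable.pred M (\<lambda>\<omega>. P (U \<omega>) (Us b \<omega>))" for b
    using measurable_compose[OF _ P, of "\<lambda>\<omega>. (U \<omega>, Us b \<omega>)"] by simp
  then have [measurable]: "bad d \<in> events" for d unfolding bad_def by measurable
  have probA: "c \<le> prob A"
    using c by (simp add: U[symmetric] measure_distr A_def)
  have prob_bad: "prob (bad d) \<le> s ^ d * s ^ d" for d
  proof -
    have "prob (bad d) \<le> (1 - min q (1 / 2)) ^ d"
      unfolding bad_def using q(2) by (intro prob_no_success_le[OF ind U Us K P]) force+
    then show ?thesis by (simp add: s2[symmetric] power_mult_distrib)
  qed
  have A_sub: "A \<subseteq> E d \<union> bad d" for d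
    using sub[of d] unfolding A_def bad_def by blast
  define c\<^sub>1 where "c\<^sub>1 = - ln s"
  have c1: "c\<^sub>1 > 0" using s by (simp add: c\<^sub>1_def)
  have exp: "exp (- c\<^sub>1 * real d) = s ^ d" for d
    using s by (simp add: c\<^sub>1_def exp_of_nat_mult mult.commute)
  have s_lim: "(\<lambda>d. s ^ d) \<longlonglongrightarrow> 0" using s by (intro LIMSEQ_power_zero) simp
  have "(\<lambda>d. s ^ d * s ^ d) \<in> o(\<lambda>d. s ^ d)"
    using s s_lim by (intro smalloI_tendsto) auto
  moreover have "c - s ^ d * s ^ d \<le> prob (E d)" for d
  proof -
    have "prob A \<le> prob (E d \<union> bad d)"
      by (rule finite_measure_mono[OF A_sub]) measurable
    also have "\<dots> \<le> prob (E d) + prob (bad d)" by (rule measure_subadditive) auto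
    finally show ?thesis using probA prob_bad[of d] by linarith
  qed
  \<comment> \<open>The mean of \<open>R d\<close> is \<open>prob (bad d)\<close>, so Markov's
    inequality shows that \<open>R d\<close> exceeds \<open>\<epsilon> * s ^ d\<close> with
    probability at most \<open>s ^ d / \<epsilon>\<close>.\<close>
  moreover define R where "R d = real_cond_exp M (sigma_Ud M Us d) (indicator (bad d))" for d
  moreover have "R d \<in> borel_measurable (sigma_Ud M Us d)" for d
    by (simp add: R_def)
  moreover have "little_o_p M R (\<lambda>d. s ^ d)"
    unfolding little_o_p_def
  proof (intro allI impI)
    fix \<epsilon> :: real assume \<epsilon>: "\<epsilon> > 0"
    have bound: "prob {\<omega> \<in> space M. \<bar>R d \<omega> / s ^ d\<bar> > \<epsilon>} \<le> s ^ d / \<epsilon>" for d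
    proof -
      interpret F: finite_measure_subalgebra M "sigma_Ud M Us d"
        by unfold_locales (rule subalgebra_sigma_Ud, measurable)
      have int: "integrable M (indicator (bad d) :: 'a \<Rightarrow> real)"
        by (intro integrable_real_indicator) (auto simp: emeasure_eq_measure)
      have R: "integrable M (R d)" "(\<integral>\<omega>. R d \<omega> \<partial>M) = prob (bad d)"
        using F.real_cond_exp_int[OF int] by (simp_all add: R_def Int_absorb2 sets.sets_into_space)
      have [measurable]: "R d \<in> borel_measurable M" using R(1) by auto
      have pos: "AE \<omega> in M. 0 \<le> R d \<omega>"
        unfolding R_def by (rule F.real_cond_exp_pos) auto
      have "prob {\<omega> \<in> space M. \<bar>R d \<omega> / s ^ d\<bar> > \<epsilon>} \<le> prob {\<omega> \<in> space M. \<epsilon> * s ^ d \<le> R d \<omega>}"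
      proof (rule finite_measure_mono_AE)
        show "AE \<omega> in M. \<omega> \<in> {\<omega> \<in> space M. \<bar>R d \<omega> / s ^ d\<bar> > \<epsilon>} \<longrightarrow> \<omega> \<in> {\<omega> \<in> space M. \<epsilon> * s ^ d \<le> R d \<omega>}"
          using pos by eventually_elim (use s in \<open>auto simp: pos_less_divide_eq\<close>)
      qed measurable
      also have "\<dots> \<le> (\<integral>\<omega>. R d \<omega> \<partial>M) / (\<epsilon> * s ^ d)"
        using s \<epsilon> by (intro integral_Markov_inequality_measure[OF R(1) sets.top pos]) auto
      also have "\<dots> \<le> (s ^ d * s ^ d) / (\<epsilon> * s ^ d)"
        unfolding R(2) using s \<epsilon> prob_bad[of d] by (intro divide_right_mono) auto
      also have "\<dots> = s ^ d / \<epsilon>" using s by simp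
      finally show ?thesis .
    qed
    have lim: "(\<lambda>d. s ^ d / \<epsilon>) \<longlonglongrightarrow> 0"
      using tendsto_divide[OF s_lim tendsto_const[of \<epsilon>]] \<epsilon> by simp
    show "(\<lambda>d. prob {\<omega> \<in> space M. \<bar>R d \<omega> / s ^ d\<bar> > \<epsilon>}) \<longlonglongrightarrow> 0"
    proof (rule real_tendsto_sandwich[OF _ _ tendsto_const lim])
      show "\<forall>\<^sub>F d in sequentially. prob {\<omega> \<in> space M. \<bar>R d \<omega> / s ^ d\<bar> > \<epsilon>} \<le> s ^ d / \<epsilon>"
        by (intro always_eventually allI bound)
    qed simp
  qed
  moreover have "AE \<omega> in M. c - R d \<omega> \<le> real_cond_exp M (sigma_Ud M Us d) (indicator (E d)) \<omega>" for d
  proof -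
    have sa: "subalgebra M (sigma_Ud M Us d)" by (rule subalgebra_sigma_Ud) measurable
    interpret F: finite_measure_subalgebra M "sigma_Ud M Us d" by unfold_locales (rule sa)
    have int: "integrable M (indicator S :: 'a \<Rightarrow> real)" if "S \<in> events" for S
      using that by (intro integrable_real_indicator) (auto simp: emeasure_eq_measure)
    \<comment> \<open>The event \<open>A\<close> concerns \<open>U\<close> alone, so conditioning on
      the draws leaves its probability unchanged.\<close>
    have "AE \<omega> in M. real_cond_exp M (sigma_Ud M Us d) (indicator A) \<omega> = prob A"
      using prob_indep_sigma_Ud[OF ind K] by (intro real_cond_exp_indep sa) (auto simp: A_def)
    moreover have "AE \<omega> in M. real_cond_exp M (sigma_Ud M Us d) (\<lambda>\<omega>. indicator A \<omega> - indicator (bad d) \<omega>) \<omega>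
        \<le> real_cond_exp M (sigma_Ud M Us d) (indicator (E d)) \<omega>"
    proof (rule F.real_cond_exp_mono)
      show "AE \<omega> in M. indicator A \<omega> - indicator (bad d) \<omega> \<le> (indicator (E d) \<omega> :: real)"
        using A_sub[of d] by (intro AE_I2) (auto simp: indicator_def)
    qed (auto intro!: int)
    moreover have "AE \<omega> in M. real_cond_exp M (sigma_Ud M Us d) (\<lambda>\<omega>. indicator A \<omega> - indicator (bad d) \<omega>) \<omega>
        = real_cond_exp M (sigma_Ud M Us d) (indicator A) \<omega> - R d \<omega>"
      unfolding R_def by (intro F.real_cond_exp_diff int) auto
    ultimately show ?thesis
      by eventually_elim (use probA in linarith)
  qed
  ultimately show ?thesis
    using c1 by (intro exI[of _ c\<^sub>1] conjI exI[of _ "\<lambda>d. s ^ d * s ^ d"] exI[of _ R]) (simp_all only: exp, simp_all)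
qed

section \<open>Choice of \<gamma> and assembly of the two bounds\<close>

theorem theorem8:
  fixes X :: "real^'p^'n" and \<tau>\<^sub>0 :: "'p set" and \<beta>\<^sub>0 :: "real^'p" and \<sigma>\<^sub>0 \<alpha> \<delta> :: real
    and tbS tbT :: "'p set set \<Rightarrow> 'p set"
    and M :: "'w measure" and U :: "'w \<Rightarrow> real^'n" and Us :: "nat \<Rightarrow> 'w \<Rightarrow> real^'n"
    and Y :: "'w \<Rightarrow> real^'n"
  assumes "\<tau>\<^sub>0 \<noteq> {}" and "\<sigma>\<^sub>0 > 0" and "identifiable X \<tau>\<^sub>0 \<beta>\<^sub>0"
    and "tie_breaking tbS" and "tie_breaking tbT"
    and "prob_space M"
    and "prob_space.indep_vars M (\<lambda>_. borel) (case_option U Us) UNIV"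
    and "distr M borel U = std_normal_vec" and "\<And>b. distr M borel (Us b) = std_normal_vec"
    and "\<And>\<omega>. Y \<omega> = submodel X \<tau>\<^sub>0 \<beta>\<^sub>0 + \<sigma>\<^sub>0 *\<^sub>R U \<omega>"
    and "0 < \<alpha>" and "\<alpha> < 1" and "real CARD('n) - real (card \<tau>\<^sub>0) > 4" and "\<delta> > 0"
  shows "\<exists>\<gamma>. 0 < \<gamma> \<and> \<gamma> < 1 \<and>
    (let n = real CARD('n);
         lo = 4 * n * \<gamma> powr (1/2)
                * (2 + 2 * (real (card \<tau>\<^sub>0) + 1) * (ln (real CARD('p) / 2) / n)) * \<sigma>\<^sub>0\<^sup>2;
         hi = n * \<gamma> powr (1/4) / 6 * C_min X \<tau>\<^sub>0 \<beta>\<^sub>0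
     in lo \<le> hi \<and>
        (\<forall>lam\<in>{lo..hi}.
           let E = (\<lambda>d. {\<omega> \<in> space M.
                 \<tau>\<^sub>0 \<in> confidence_set tbS tbT X \<alpha> lam (Y \<omega>) (\<lambda>b. Us b \<omega>) d})
           in \<exists>c\<^sub>1>0.
             (\<exists>r. r \<in> o(\<lambda>d. exp (- c\<^sub>1 * real d)) \<and>
                (\<forall>d. measure M (E d) \<ge> \<alpha> - \<delta> - r d)) \<and>
             (\<exists>R. (\<forall>d. R d \<in> borel_measurable (sigma_Ud M Us d)) \<and>
                little_o_p M R (\<lambda>d. exp (- c\<^sub>1 * real d)) \<and>
                (\<forall>d. AE \<omega> in M.
                   real_cond_exp M (sigma_Ud M Us d) (indicator (E d)) \<omega> \<ge> \<alpha> - \<delta> - R d \<omega>))))"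
proof -
  interpret prob_space M by fact
  let ?N = "std_normal_vec :: (real^'n) measure"
  interpret N: prob_space ?N by (rule prob_space_std_normal_vec)
  define n where "n = real CARD('n)"
  define C where "C = C_min X \<tau>\<^sub>0 \<beta>\<^sub>0"
  define L where "L = 2 + 2 * (real (card \<tau>\<^sub>0) + 1) * (ln (real CARD('p) / 2) / n)"
  define y where "y u = submodel X \<tau>\<^sub>0 \<beta>\<^sub>0 + \<sigma>\<^sub>0 *\<^sub>R u" for u
  have rv: "case_option U Us i \<in> borel_measurable M" for i
    using assms(7) by (auto simp: indep_vars_def)
  have [measurable]: "U \<in> borel_measurable M" "Us b \<in> borel_measurable M" for b
    using rv[of None] rv[of "Some b"] by auto
  have k: "0 < real (card \<tau>\<^sub>0)" using assms(1) by (simp add: card_gt_0_iff)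
  have n: "0 < n" by (simp add: n_def)
  have C: "0 < C" unfolding C_def by (rule C_min_pos) fact+
  \<comment> \<open>The logarithm is negative only for \<open>p = 1\<close>. Then
    \<open>\<tau>\<^sub>0\<close> has one element, and \<open>n > 5\<close> with
    \<open>ln (1 / 2) \<ge> - 1\<close> keeps the bracket above \<open>2 - 4 / 5\<close>.\<close>
  have L: "0 < L"
  proof (cases "CARD('p) = 1")
    case True
    have "card \<tau>\<^sub>0 \<le> CARD('p)" by (intro card_mono) auto
    then have "card \<tau>\<^sub>0 = 1" using True k by simp
    then have "5 < n" using assms(13) by (simp add: n_def)
    have "- ln (1 / 2) \<le> (1::real)" using ln_le_minus_one[of "2::real"] by (simp add: ln_div)
    then have "- 1 / n \<le> ln (1 / 2) / n" using n by (intro divide_right_mono) auto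
    moreover have "1 / n < 1 / 5" using \<open>5 < n\<close> by (simp add: divide_simps)
    ultimately show ?thesis unfolding L_def using True \<open>card \<tau>\<^sub>0 = 1\<close> by simp
  next
    case False
    have "CARD('p) \<noteq> 0" by simp
    then have "2 \<le> CARD('p)" using False by linarith
    then have "0 \<le> ln (real CARD('p) / 2)" by (intro ln_ge_zero) simp
    then show ?thesis unfolding L_def using n by (intro add_pos_nonneg mult_nonneg_nonneg divide_nonneg_pos) auto
  qed
  have "card \<tau>\<^sub>0 + 1 < CARD('n)" using assms(13) by linarith
  from profile_rss_threshold[OF assms(1,3) this assms(14), of \<sigma>\<^sub>0] obtain \<kappa> where \<kappa>: "\<kappa> > 0"
    "1 - \<delta> < measure ?N {u. \<forall>\<tau>. \<tau> \<noteq> \<tau>\<^sub>0 \<longrightarrow> card \<tau> \<le> card \<tau>\<^sub>0 \<longrightarrow> \<kappa> < profile_rss X \<tau> (y u) u}"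
    unfolding y_def by blast
  \<comment> \<open>The three bounds ensure, in order, \<gamma> below \<open>1\<close>, a nonempty
    penalty interval, and \<open>hi * real (card \<tau>\<^sub>0) \<le> \<kappa>\<close>.\<close>
  define g where "g = min (1 / 2) (min (C / (24 * L * \<sigma>\<^sub>0\<^sup>2)) (6 * \<kappa> / (n * C * real (card \<tau>\<^sub>0))))"
  have g: "0 < g" "g < 1" "g \<le> C / (24 * L * \<sigma>\<^sub>0\<^sup>2)" "g \<le> 6 * \<kappa> / (n * C * real (card \<tau>\<^sub>0))"
    using C L n k \<kappa>(1) assms(2) by (auto simp: g_def)
  \<comment> \<open>With the fourth power, \<open>lo\<close> is quadratic and \<open>hi\<close>
    linear in \<open>g\<close>, so a small \<open>g\<close> puts them in the right order.\<close>
  define \<gamma> where "\<gamma> = g powr 4"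
  have "g ^ 4 < 1" using g by (simp add: power_less_one_iff)
  have \<gamma>: "0 < \<gamma>" "\<gamma> < 1" "\<gamma> powr (1 / 2) = g\<^sup>2" "\<gamma> powr (1 / 4) = g"
    using g \<open>g ^ 4 < 1\<close> unfolding \<gamma>_def powr_powr by simp_all
  define lo where "lo = 4 * n * \<gamma> powr (1/2) * L * \<sigma>\<^sub>0\<^sup>2"
  define hi where "hi = n * \<gamma> powr (1/4) / 6 * C"
  have "g * (24 * L * \<sigma>\<^sub>0\<^sup>2) \<le> C" using g(3) L assms(2) by (simp add: pos_le_divide_eq)
  then have "n * g / 6 * (g * (24 * L * \<sigma>\<^sub>0\<^sup>2)) \<le> n * g / 6 * C" using n g by (intro mult_left_mono) auto
  then have lohi: "lo \<le> hi" by (simp add: lo_def hi_def \<gamma> power2_eq_square mult_ac)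
  have lo: "0 < lo" using n g L assms(2) by (simp add: lo_def \<gamma>)
  have "hi * real (card \<tau>\<^sub>0) \<le> \<kappa>"
    using g(4) n C k by (simp add: hi_def \<gamma> pos_le_divide_eq mult_ac)
  define Cov where "Cov = {u. T_tilde tbT X (y u) \<tau>\<^sub>0 \<in> B_set tbT X \<alpha> \<tau>\<^sub>0 (W_tilde X (y u) \<tau>\<^sub>0)}"
  have "submodel X \<tau>\<^sub>0 \<beta>\<^sub>0 \<in> column_span X \<tau>\<^sub>0" using range_submodel[of X \<tau>\<^sub>0] by auto
  then have "ennreal \<alpha> \<le> emeasure ?N Cov"
    unfolding Cov_def y_def using assms by (intro emeasure_coverage) auto
  then have Cov\<alpha>: "\<alpha> \<le> measure ?N Cov" using assms(11) by (simp add: N.emeasure_eq_measure)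
  have "Measurable.pred borel (\<lambda>u. T_tilde tbT X (y u) \<tau>\<^sub>0 \<in> B_set tbT X \<alpha> \<tau>\<^sub>0 (W_tilde X (y u) \<tau>\<^sub>0))"
    by (rule measurable_compose[OF _ pred_coverage]) (simp add: y_def)
  then have [measurable]: "Cov \<in> sets borel"
    by (simp only: Cov_def pred_def space_borel UNIV_I simp_thms)
  have main: "\<exists>c\<^sub>1>0. (\<exists>r. r \<in> o(\<lambda>d. exp (- c\<^sub>1 * real d)) \<and> (\<forall>d. \<alpha> - \<delta> - r d \<le> prob (E d))) \<and>
      (\<exists>R. (\<forall>d. R d \<in> borel_measurable (sigma_Ud M Us d)) \<and>
         little_o_p M R (\<lambda>d. exp (- c\<^sub>1 * real d)) \<and>
         (\<forall>d. AE \<omega> in M. \<alpha> - \<delta> - R d \<omega> \<le> real_cond_exp M (sigma_Ud M Us d) (indicator (E d)) \<omega>))"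
    if lam: "lam \<in> {lo..hi}" and E: "E = (\<lambda>d. {\<omega> \<in> space M.
        \<tau>\<^sub>0 \<in> confidence_set tbS tbT X \<alpha> lam (Y \<omega>) (\<lambda>b. Us b \<omega>) d})" for lam E
  proof -
    let ?P = "\<lambda>u v. tau_hat tbS X lam (y u) v = \<tau>\<^sub>0"
    have lam0: "0 < lam" using lam lo by simp
    have "lam * real (card \<tau>\<^sub>0) \<le> hi * real (card \<tau>\<^sub>0)" using lam k by (intro mult_right_mono) auto
    also have "\<dots> \<le> \<kappa>" by fact
    \<comment> \<open>This \<open>q\<close>, and with it the rate \<open>c\<^sub>1\<close>, may
      depend on \<open>lam\<close>.\<close>
    finally obtain q where q: "q > 0" "1 - \<delta> < measure ?N {u. q < measure ?N {v. ?P u v}}"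
      using detection_probability_threshold[OF assms(4) lam0, of \<tau>\<^sub>0 \<kappa> "1 - \<delta>" X \<beta>\<^sub>0 \<sigma>\<^sub>0] \<kappa>(2)
      unfolding y_def by blast
    define D where "D = {u. q < measure ?N {v. ?P u v}}"
    have P: "Measurable.pred (borel \<Otimes>\<^sub>M borel) (\<lambda>z. ?P (fst z) (snd z))"
      unfolding y_def by (rule pred_detection)
    have "(\<lambda>u. measure ?N {v. ?P u v}) \<in> borel_measurable borel"
      unfolding y_def by (rule measurable_detection_probability)
    then have [measurable]: "D \<in> sets borel" unfolding D_def by measurable
    \<comment> \<open>Coverage and detectability concern the same noise vector; a union bound on the
      complements combines them at a cost below \<delta>.\<close>
    have "1 - measure ?N (Cov \<inter> D) \<le> (1 - measure ?N Cov) + (1 - measure ?N D)"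
    proof -
      have "measure ?N (UNIV - Cov \<inter> D) \<le> measure ?N (UNIV - Cov) + measure ?N (UNIV - D)"
        unfolding Diff_Int by (intro measure_subadditive) auto
      then show ?thesis using N.prob_compl[of Cov] N.prob_compl[of D] N.prob_compl[of "Cov \<inter> D"] by simp
    qed
    then have c: "\<alpha> - \<delta> \<le> measure ?N (Cov \<inter> D)" using q(2) Cov\<alpha> by (simp add: D_def)
    \<comment> \<open>Membership splits into coverage, which depends on \<open>U\<close> alone, and
      detection by at least one draw. The set \<open>D\<close> enters only through the uniform bound
      \<open>q\<close>.\<close>
    have E_eq: "E d = {\<omega> \<in> space M. U \<omega> \<in> Cov \<and> (\<exists>b<d. ?P (U \<omega>) (Us b \<omega>))}" for d
      by (auto simp: E confidence_set_def candidate_set_def Cov_def y_def assms(10) image_iff)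
    show ?thesis
    proof (rule exponential_lower_bounds[OF assms(7-9) _ c P q(1)])
      fix d
      have "Measurable.pred M (\<lambda>\<omega>. ?P (U \<omega>) (Us b \<omega>))" for b
        using measurable_compose[OF _ P, of "\<lambda>\<omega>. (U \<omega>, Us b \<omega>)"] by simp
      then show "E d \<in> events" unfolding E_eq by measurable
    next
      show "Cov \<inter> D \<in> sets borel" by measurable
    qed (auto simp: D_def E_eq)
  qed
  have "lo \<le> hi \<and> (\<forall>lam\<in>{lo..hi}.
           let E = (\<lambda>d. {\<omega> \<in> space M.
                 \<tau>\<^sub>0 \<in> confidence_set tbS tbT X \<alpha> lam (Y \<omega>) (\<lambda>b. Us b \<omega>) d})
           in \<exists>c\<^sub>1>0.
             (\<exists>r. r \<in> o(\<lambda>d. exp (- c\<^sub>1 * real d)) \<and>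
                (\<forall>d. measure M (E d) \<ge> \<alpha> - \<delta> - r d)) \<and>
             (\<exists>R. (\<forall>d. R d \<in> borel_measurable (sigma_Ud M Us d)) \<and>
                little_o_p M R (\<lambda>d. exp (- c\<^sub>1 * real d)) \<and>
                (\<forall>d. AE \<omega> in M.
                   real_cond_exp M (sigma_Ud M Us d) (indicator (E d)) \<omega> \<ge> \<alpha> - \<delta> - R d \<omega>)))"
    using lohi main unfolding Let_def by blast
  then show ?thesis
    unfolding Let_def lo_def hi_def n_def[symmetric] L_def[symmetric] C_def[symmetric]
    using \<gamma>(1,2) by blast
qed

end
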